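(* Let $\mathcal{A}$ be a finite nonempty set and $d \in \mathbb{N}$, $d\ge 1$. For each $n\ge 1$, let $\mathcal{G}_n$ be the event that $X_\omega$ is nonempty but contains no finite orbits, where $\omega$ is drawn according to $\mathbb{P}_{n,\alpha}$. Then for each $\alpha\in[0,1]$, $$\lim_{n\to\infty} \mathbb{P}_{n,\alpha}(\mathcal{G}_n) = 0.$$ Furthermore, for $\alpha \neq |\mathcal{A}|^{-1}$, the rate of convergence to this limit is at least exponential in $n$; that is, there exist $C>0$, $\beta\in(0,1)$ and $n_0$ (depending on $\mathcal{A}$, $d$, $\alpha$) such that $\mathbb{P}_{n,\alpha}(\mathcal{G}_n)\le C\beta^n$ for all $n\ge n_0$.
   Context: Let $F_n = [1,n]^d \subset \mathbb{Z}^d$ (integer points). Let $\Omega_n$ be the power set of $\mathcal{A}^{F_n}$. For $\alpha\in[0,1]$, $\mathbb{P}_{n,\alpha}$ is the probability measure on $\Omega_n$ under which the random subset $\omega \subset \mathcal{A}^{F_n}$ includes each element of $\mathcal{A}^{F_n}$ independently with probability $\alpha$. For $\omega \subset \mathcal{A}^{F_n}$, $$X_\omega = \{x \in \mathcal{A}^{\mathbb{Z}^d} : \forall p \in \mathbb{Z}^d,\ x|_{F_n+p} \in \omega\},$$ where patterns are identified up to translation. The shift action is $(\sigma^p(x))_q = x_{p+q}$ for $p,q\in\mathbb{Z}^d$. A finite orbit in $X_\omega$ is a nonempty finite set $\gamma\subset X_\omega$ such that $\{\sigma^p(x): p \in \mathbb{Z}^d\} = \gamma$ for every $x\in\gamma$.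 *)

theory Defs
  imports "HOL-Probability.Probability" "HOL-Probability.Product_PMF"
begin

text \<open>
  The lattice of dimension \<open>d\<close> is \<open>int ^ 'd\<close>, with \<open>d = CARD('d)\<close>; the alphabet is a set \<open>A\<close>.
\<close>

type_synonym ('a, 'd) config = "int ^ 'd \<Rightarrow> 'a"

definition cube :: "nat \<Rightarrow> (int ^ 'd) set" where
  "cube n = {p. \<forall>i. 1 \<le> p $ i \<and> p $ i \<le> int n}"

text \<open>A pattern on a finite shape is represented by its extension by \<^const>\<open>undefined\<close>.\<close>

definition patterns :: "'a set \<Rightarrow> nat \<Rightarrow> ('a, 'd::finite) config set" where
  "patterns A n = cube n \<rightarrow>\<^sub>E A"

definition shift :: "int ^ 'd \<Rightarrow> ('a, 'd::finite) config \<Rightarrow> ('a, 'd) config" where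
  "shift p x = (\<lambda>q. x (p + q))"

text \<open>
  Patterns being identified up to translation, the pattern of \<open>x\<close> on \<open>cube n + p\<close> is
  the restriction of \<open>shift p x\<close> to \<open>cube n\<close>.
\<close>

definition SFT :: "'a set \<Rightarrow> nat \<Rightarrow> ('a, 'd) config set \<Rightarrow> ('a, 'd::finite) config set" where
  "SFT A n \<omega> = {x. range x \<subseteq> A \<and> (\<forall>p. restrict (shift p x) (cube n) \<in> \<omega>)}"

definition finite_orbit :: "('a, 'd::finite) config set \<Rightarrow> ('a, 'd) config set \<Rightarrow> bool" where
  "finite_orbit X \<gamma> \<longleftrightarrow>
     \<gamma> \<noteq> {} \<and> finite \<gamma> \<and> \<gamma> \<subseteq> X \<and> (\<forall>x\<in>\<gamma>. range (\<lambda>p. shift p x) = \<gamma>)"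

text \<open>Each pattern is kept independently with probability \<open>\<alpha>\<close>, for \<open>0 \<le> \<alpha> \<le> 1\<close>.\<close>

definition random_patterns :: "'a set \<Rightarrow> nat \<Rightarrow> real \<Rightarrow> ('a, 'd::finite) config set pmf" where
  "random_patterns A n \<alpha> =
     map_pmf (\<lambda>f. {w \<in> patterns A n. f w})
       (Pi_pmf (patterns A n) False (\<lambda>_. bernoulli_pmf \<alpha>))"

definition aperiodic_event :: "'a set \<Rightarrow> nat \<Rightarrow> ('a, 'd::finite) config set set" where
  "aperiodic_event A n =
     {\<omega> \<in> Pow (patterns A n). SFT A n \<omega> \<noteq> {} \<and> \<not> (\<exists>\<gamma>. finite_orbit (SFT A n \<omega>) \<gamma>)}"

lemma finite_cube: "finite (cube n :: (int ^ 'd) set)"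
proof -
  have "cube n \<subseteq> vec_lambda ` (UNIV \<rightarrow>\<^sub>E {1..int n} :: ('d \<Rightarrow> int) set)"
  proof
    fix p :: "int ^ 'd" assume "p \<in> cube n"
    then have "vec_nth p \<in> UNIV \<rightarrow>\<^sub>E {1..int n}" by (auto simp: cube_def)
    moreover have "p = vec_lambda (vec_nth p)" by simp
    ultimately show "p \<in> vec_lambda ` (UNIV \<rightarrow>\<^sub>E {1..int n})" by blast
  qed
  moreover have "finite (UNIV \<rightarrow>\<^sub>E {1..int n} :: ('d \<Rightarrow> int) set)"
    by (intro finite_PiE) auto
  ultimately show ?thesis by (meson finite_imageI finite_subset)
qed

text \<open>\<^const>\<open>Pi_pmf\<close> is a product distribution only over a finite index set.\<close>

lemma finite_patterns: "finite A \<Longrightarrow> finite (patterns A n :: ('a, 'd::finite) config set)"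
  unfolding patterns_def by (intro finite_PiE finite_cube)

end

theory Submission imports Defs begin

text \<open>
  Let \<open>q = card A\<close>.

  For \<open>\<alpha> q < 1\<close>, take a point \<open>x\<close> of a shift without finite orbits and let \<open>N r\<close> be the number of
  \<open>n\<close>-patterns of \<open>x\<close> in the ball of radius \<open>r\<close>. By a Morse--Hedlund argument \<open>N (3 n) > n\<close>, and
  as \<open>N\<close> grows polynomially there is a radius \<open>r\<close> of order at most \<open>n log n\<close> with
  \<open>N (r + 2 n) \<le> (1 + \<delta>) N r\<close>. The letters of \<open>x\<close> in the ball of radius \<open>r + n\<close> depend only on the
  surrounding \<open>n\<close>-patterns, and the relation of having the same \<open>n\<close>-pattern is generated by
  polylogarithmically many pairs of positions. Hence up to a subexponential factor there are at most
  \<open>q\<close> to the power \<open>(1 + \<delta>) N r\<close> such blocks, each allowed with probability \<open>\<alpha>\<close> to the power \<open>N r\<close>, where \<open>N r > n\<close>.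

  For \<open>\<alpha> q \<ge> 1\<close> and \<open>q \<ge> 2\<close>, consider the points that depend on one coordinate only, periodically with
  least period \<open>k \<le> n div 2\<close>. Their orbits involve at most \<open>k\<close> patterns each, distinct orbits involve
  disjoint sets of patterns, and there are at least \<open>q ^ k / (2 k)\<close> orbits for each \<open>k \<ge> 3\<close>. So the
  probability that none is allowed is at most \<open>exp (- (\<Sum>k = 3..n div 2. (\<alpha> q) ^ k / (2 k)))\<close>.
\<close>

section \<open>Low complexity forces finite orbits\<close>

definition pat :: "nat \<Rightarrow> ('a, 'd::finite) config \<Rightarrow> int ^ 'd \<Rightarrow> ('a, 'd) config" where
  "pat n x t = restrict (shift t x) (cube n)"

lemma pat_eq_iff:
  fixes x y :: "('a, 'd::finite) config"
  shows "pat n x s = pat n y t \<longleftrightarrow> (\<forall>a\<in>cube n. x (s + a) = y (t + a))"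
proof
  assume eq: "pat n x s = pat n y t"
  show "\<forall>a\<in>cube n. x (s + a) = y (t + a)"
  proof
    fix a :: "int ^ 'd" assume "a \<in> cube n"
    then show "x (s + a) = y (t + a)" using fun_cong[OF eq, of a] by (simp add: pat_def shift_def)
  qed
qed (auto simp: pat_def shift_def restrict_def)

lemma SFT_iff: "x \<in> SFT A n \<omega> \<longleftrightarrow> range x \<subseteq> A \<and> range (pat n x) \<subseteq> \<omega>"
  by (auto simp: SFT_def pat_def)

lemma shift_shift: "shift p (shift q x) = shift (q + p) x"
  by (simp add: shift_def fun_eq_iff add.assoc)

lemma shift_in_SFT: "x \<in> SFT A n \<omega> \<Longrightarrow> shift p x \<in> SFT A n \<omega>"
  by (auto simp: SFT_def shift_shift) (auto simp: shift_def)

lemma finite_int_box: "finite {p :: int ^ 'd::finite. \<forall>i. a i \<le> p $ i \<and> p $ i \<le> b i}"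
proof -
  have "{p :: int ^ 'd. \<forall>i. a i \<le> p $ i \<and> p $ i \<le> b i} \<subseteq> vec_lambda ` (Pi\<^sub>E UNIV (\<lambda>i. {a i..b i}))"
  proof
    fix p :: "int ^ 'd" assume "p \<in> {p. \<forall>i. a i \<le> p $ i \<and> p $ i \<le> b i}"
    then have "vec_nth p \<in> Pi\<^sub>E UNIV (\<lambda>i. {a i..b i})" by auto
    moreover have "p = vec_lambda (vec_nth p)" by simp
    ultimately show "p \<in> vec_lambda ` (Pi\<^sub>E UNIV (\<lambda>i. {a i..b i}))" by blast
  qed
  moreover have "finite (Pi\<^sub>E (UNIV :: 'd set) (\<lambda>i. {a i..b i}))" by (intro finite_PiE) auto
  ultimately show ?thesis by (meson finite_imageI finite_subset)
qed

lemma card_int_box: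
  assumes "\<And>i. a i \<le> b i + 1"
  shows "int (card {p :: int ^ 'd::finite. \<forall>i. a i \<le> p $ i \<and> p $ i \<le> b i}) = (\<Prod>i\<in>UNIV. b i - a i + 1)"
proof -
  have "bij_betw vec_nth {p :: int ^ 'd. \<forall>i. a i \<le> p $ i \<and> p $ i \<le> b i} (Pi\<^sub>E UNIV (\<lambda>i. {a i..b i}))"
    by (rule bij_betwI[where g = vec_lambda]) auto
  then have "card {p :: int ^ 'd. \<forall>i. a i \<le> p $ i \<and> p $ i \<le> b i} = card (Pi\<^sub>E (UNIV :: 'd set) (\<lambda>i. {a i..b i}))"
    by (rule bij_betw_same_card)
  also have "int \<dots> = (\<Prod>i\<in>UNIV. b i - a i + 1)"
    using assms by (simp add: card_PiE algebra_simps)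
  finally show ?thesis .
qed

text \<open>Reducing a shift vector modulo \<open>\<pi>\<close> does not change the shifted point,
  so the vectors of one finite box already produce the whole orbit of \<open>y\<close>.\<close>

lemma periodic_imp_finite_orbit:
  fixes y :: "('a, 'd::finite) config" and \<pi> :: "'d \<Rightarrow> int"
  assumes pos: "\<And>i. \<pi> i > 0"
    and per: "\<And>c c'. (\<And>i. c $ i mod \<pi> i = c' $ i mod \<pi> i) \<Longrightarrow> y c = y c'"
    and y: "y \<in> SFT A n \<omega>"
  shows "\<exists>\<gamma>. finite_orbit (SFT A n \<omega>) \<gamma>"
proof -
  let ?\<gamma> = "range (\<lambda>p. shift p y)"
  let ?B = "{p :: int ^ 'd. \<forall>i. 0 \<le> p $ i \<and> p $ i \<le> \<pi> i}"
  have "?\<gamma> \<subseteq> (\<lambda>p. shift p y) ` ?B"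
  proof clarify
    fix p :: "int ^ 'd"
    let ?p = "\<chi> i. p $ i mod \<pi> i"
    have "?p \<in> ?B" using pos by (auto simp: less_imp_le)
    moreover have "shift p y = shift ?p y"
      unfolding shift_def by (rule ext, rule per) (simp add: mod_simps)
    ultimately show "shift p y \<in> (\<lambda>p. shift p y) ` ?B" by blast
  qed
  then have "finite ?\<gamma>" by (rule finite_subset) (intro finite_imageI finite_int_box)
  moreover have "range (\<lambda>p. shift p (shift q y)) = ?\<gamma>" for q
  proof -
    have "range (\<lambda>p. shift (q + p) y) = (\<lambda>p. shift p y) ` range ((+) q)"
      by (simp only: image_image)
    also have "range ((+) q) = UNIV" by (rule surj_plus)
    finally show ?thesis by (simp add: shift_shift)
  qed
  moreover have "?\<gamma> \<subseteq> SFT A n \<omega>" using y shift_in_SFT by blast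
  ultimately have "finite_orbit (SFT A n \<omega>) ?\<gamma>" unfolding finite_orbit_def by auto
  then show ?thesis ..
qed

text \<open>Strict growth at every step below \<open>n\<close> would give \<open>m < f m\<close> for
  all \<open>m \<le> n\<close>, against \<open>f n \<le> n\<close>.\<close>

lemma mono_bounded_stationary:
  fixes f :: "nat \<Rightarrow> nat"
  assumes "\<And>m. f m \<le> f (Suc m)" "0 < f 0" "f n \<le> n"
  obtains m where "m < n" "f m = f (Suc m)"
proof (rule ccontr)
  assume "\<not> thesis"
  then have neq: "f m \<noteq> f (Suc m)" if "m < n" for m using that \<open>\<And>m. m < n \<Longrightarrow> f m = f (Suc m) \<Longrightarrow> thesis\<close> by blast
  have "m \<le> n \<Longrightarrow> m < f m" for m
  proof (induction m)
    case (Suc m)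
    then have "m < f m" "f m \<noteq> f (Suc m)" "f m \<le> f (Suc m)" using neq assms(1) by auto
    then show ?case by linarith
  qed (use assms in simp)
  then show False using assms(3) by fastforce
qed

lemma cube_mono: "m \<le> n \<Longrightarrow> a \<in> cube m \<Longrightarrow> a \<in> cube n"
  unfolding cube_def by (simp, meson of_nat_le_iff order_trans)

text \<open>The Morse--Hedlund argument: if the number of patterns does not grow from size \<open>m\<close> to size
  \<open>m + 1\<close>, then on \<open>S\<close> a pattern of size \<open>m\<close> determines its translates by unit vectors, and the
  pigeonhole principle on every axis yields periods.\<close>

lemma low_complexity_imp_finite_orbit:
  fixes x :: "('a, 'd::finite) config" and n :: nat
  defines "S \<equiv> {t :: int ^ 'd. \<forall>i. 0 \<le> t $ i \<and> t $ i \<le> 3 * int n}"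
  assumes x: "x \<in> SFT A n \<omega>" and few: "card (pat n x ` S) \<le> n"
  shows "\<exists>\<gamma>. finite_orbit (SFT A n \<omega>) \<gamma>"
proof -
  have finS: "finite S" unfolding S_def by (rule finite_int_box)
  have "0 \<in> S" by (simp add: S_def)
  define P where "P m = card (pat m x ` S)" for m
  have restr: "pat m x t = restrict (pat (Suc m) x t) (cube m)" for m t
  proof -
    have "cube (Suc m) \<inter> cube m = (cube m :: (int ^ 'd) set)" 
      using cube_mono[of m "Suc m"] by auto
    then show ?thesis unfolding pat_def by simp
  qed
  have img: "pat m x ` S = (\<lambda>w. restrict w (cube m)) ` (pat (Suc m) x ` S)" for m
    unfolding image_image restr[symmetric] ..
  have "P m \<le> P (Suc m)" for m
    unfolding P_def img[of m] by (rule card_image_le) (simp add: finS)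
  moreover have "0 < P 0" unfolding P_def using finS \<open>0 \<in> S\<close> by (auto simp: card_gt_0_iff)
  ultimately obtain m where m: "m < n" "P m = P (Suc m)"
    using mono_bounded_stationary[of P n] few unfolding P_def by metis
  have pn: "P m \<le> n"
  proof -
    have "P i \<le> P j" if "i \<le> j" for i j
      using that by (rule lift_Suc_mono_le[rotated]) fact
    then show ?thesis using m few unfolding P_def by (meson less_imp_le order_trans)
  qed
  \<comment> \<open>Restriction maps the patterns of size \<open>Suc m\<close> onto those of size
    \<open>m\<close>; both sets have \<open>P m\<close> elements, so it is injective.\<close>
  have inj: "inj_on (\<lambda>w. restrict w (cube m)) (pat (Suc m) x ` S)"
  proof (rule eq_card_imp_inj_on)
    show "finite (pat (Suc m) x ` S)" using finS by simp
    show "card ((\<lambda>w. restrict w (cube m)) ` pat (Suc m) x ` S) = card (pat (Suc m) x ` S)"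
      unfolding img[symmetric] using m(2) by (simp add: P_def)
  qed
  have det: "pat (Suc m) x t = pat (Suc m) x t'" if "t \<in> S" "t' \<in> S" "pat m x t = pat m x t'" for t t'
  proof (rule inj_onD[OF inj])
    show "restrict (pat (Suc m) x t) (cube m) = restrict (pat (Suc m) x t') (cube m)"
      using that(3) by (simp only: restr[symmetric])
  qed (use that in auto)
  \<comment> \<open>A pattern of size \<open>Suc m\<close> at \<open>t\<close> contains the pattern
    of size \<open>m\<close> at \<open>t + axis i 1\<close>.\<close>
  have det1: "pat m x (t + axis i 1) = pat m x (t' + axis i 1)"
    if "t \<in> S" "t' \<in> S" "pat m x t = pat m x t'" for t t' i
    using det[OF that] unfolding pat_eq_iff
  proof safe
    fix a :: "int ^ 'd" assume *: "\<forall>a\<in>cube (Suc m). x (t + a) = x (t' + a)" "a \<in> cube m"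
    have "1 \<le> (axis i 1 + a) $ j \<and> (axis i 1 + a) $ j \<le> int (Suc m)" for j
    proof -
      have "1 \<le> a $ j" "a $ j \<le> int m" using *(2) by (auto simp: cube_def)
      then show ?thesis by (auto simp: axis_def)
    qed
    then have "axis i 1 + a \<in> cube (Suc m)" by (simp add: cube_def)
    then show "x (t + axis i 1 + a) = x (t' + axis i 1 + a)" using *(1) by (simp add: add.assoc)
  qed
  \<comment> \<open>Unit steps are chained. Intermediate positions stay in \<open>S\<close> because
    each of their coordinates lies between those of the end points.\<close>
  have det_vec: "pat m x (t + s) = pat m x (t' + s)"
    if "t \<in> S" "t' \<in> S" "pat m x t = pat m x t'" "\<And>i. 0 \<le> s $ i" "t + s \<in> S" "t' + s \<in> S" for t t' s
    using that(4-6)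
  proof (induction "nat (\<Sum>i\<in>UNIV. s $ i)" arbitrary: s rule: less_induct)
    case less
    show ?case
    proof (cases "s = 0")
      case True then show ?thesis using that by simp
    next
      case False
      then obtain i where "s $ i \<noteq> 0" by (auto simp: vec_eq_iff)
      with less.prems(1) have i: "s $ i \<ge> 1" by (smt (verit))
      define s' where "s' = s - axis i 1"
      have s': "0 \<le> s' $ j" "s' $ j \<le> s $ j" for j using i less.prems(1)[of j] by (auto simp: s'_def axis_def)
      have "(\<Sum>i\<in>UNIV. s' $ i) < (\<Sum>i\<in>UNIV. s $ i)"
        by (rule sum_strict_mono_ex1) (use s' in \<open>auto simp: s'_def axis_def\<close>)
      moreover have "0 \<le> (\<Sum>i\<in>UNIV. s' $ i)" by (rule sum_nonneg) (use s' in auto)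
      ultimately have smaller: "nat (\<Sum>i\<in>UNIV. s' $ i) < nat (\<Sum>i\<in>UNIV. s $ i)" by linarith
      have inS: "u + s' \<in> S" if "u \<in> S" "u + s \<in> S" for u
        unfolding S_def
      proof safe
        fix j
        have "0 \<le> u $ j" "(u + s) $ j \<le> 3 * int n" using that unfolding S_def by blast+
        then show "0 \<le> (u + s') $ j" "(u + s') $ j \<le> 3 * int n" using s'[of j] by auto
      qed
      have "pat m x (t + s') = pat m x (t' + s')"
        by (rule less.hyps[OF smaller s'(1)]) (use inS that(1,2) less.prems in auto)
      then have "pat m x (t + s' + axis i 1) = pat m x (t' + s' + axis i 1)"
        by (intro det1 inS that(1,2) less.prems)
      moreover have "t + s' + axis i 1 = t + s" "t' + s' + axis i 1 = t' + s" by (simp_all add: s'_def)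
      ultimately show ?thesis by simp
    qed
  qed
  \<comment> \<open>All coordinates of \<open>t1\<close> are \<open>P m\<close>: a coincidence
    between positions \<open>a < b \<le> P m\<close> on an axis line through \<open>t1\<close> can
    be pushed forward by \<open>P m - a\<close>, to \<open>t1\<close> and \<open>t1\<close> plus a
    period.\<close>
  define t1 :: "int ^ 'd" where "t1 = (\<chi> i. int (P m))"
  have "\<exists>\<pi>. 0 < \<pi> \<and> \<pi> \<le> int (P m) \<and> pat m x t1 = pat m x (t1 + axis i \<pi>)" for i
  proof -
    define pos :: "nat \<Rightarrow> int ^ 'd" where "pos a = (\<chi> j. if j = i then int a else int (P m))" for a
    have posS: "pos a \<in> S" if "a \<le> 2 * P m" for a
      using that pn by (auto simp: S_def pos_def)
    have "card ((pat m x \<circ> pos) ` {..P m}) \<le> card (pat m x ` S)"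
      using finS posS by (intro card_mono) auto
    also have "\<dots> < card {..P m}" by (simp add: P_def)
    finally have "\<not> inj_on (pat m x \<circ> pos) {..P m}" by (rule pigeonhole)
    then obtain a b where ab: "a < b" "b \<le> P m" "pat m x (pos a) = pat m x (pos b)"
      unfolding inj_on_def by (metis atMost_iff comp_apply linorder_neqE_nat)
    have eq: "pos a + axis i (int (P m - a)) = t1" "pos b + axis i (int (P m - a)) = t1 + axis i (int (b - a))"
      using ab by (auto simp: vec_eq_iff pos_def t1_def axis_def)
    have "pos a + axis i (int (P m - a)) \<in> S" "pos b + axis i (int (P m - a)) \<in> S"
      unfolding eq using ab pn by (auto simp: S_def t1_def axis_def)
    then have "pat m x (pos a + axis i (int (P m - a))) = pat m x (pos b + axis i (int (P m - a)))"
      by (intro det_vec) (use ab posS[of a] posS[of b] in \<open>auto simp: axis_def\<close>)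
    then show ?thesis unfolding eq using ab by (intro exI[of _ "int (b - a)"]) auto
  qed
  then obtain \<pi> where \<pi>: "\<And>i. 0 < \<pi> i" "\<And>i. \<pi> i \<le> int (P m)" "\<And>i. pat m x t1 = pat m x (t1 + axis i (\<pi> i))"
    by metis
  define red :: "int ^ 'd \<Rightarrow> int ^ 'd" where "red c = (\<chi> i. c $ i mod \<pi> i)" for c
  have redn: "0 \<le> red c $ i" "red c $ i < \<pi> i" for c i using \<pi>(1)[of i] by (auto simp: red_def)
  \<comment> \<open>The periodic extension of a box of \<open>x\<close> next to \<open>t1\<close>;
    the offset 1 is there because cubes start at coordinate 1.\<close>
  define y where "y c = x (t1 + 1 + red c)" for c
  have t1S: "t1 + c \<in> S" if "\<And>i. 0 \<le> c $ i" "\<And>i. c $ i \<le> 2 * int n" for c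
    unfolding S_def
  proof safe
    fix i show "0 \<le> (t1 + c) $ i" "(t1 + c) $ i \<le> 3 * int n" using that[of i] pn by (auto simp: t1_def)
  qed
  \<comment> \<open>Periods are subtracted one at a time: \<open>det_vec\<close> moves the
    coincidence between \<open>t1\<close> and \<open>t1\<close> plus a period by the remaining
    nonnegative vector.\<close>
  have main: "pat m x (t1 + c) = pat m x (t1 + red c)" if "\<And>i. 0 \<le> c $ i" "\<And>i. c $ i \<le> 2 * int n" for c
    using that
  proof (induction "nat (\<Sum>i\<in>UNIV. c $ i)" arbitrary: c rule: less_induct)
    case less
    show ?case
    proof (cases "\<forall>i. c $ i < \<pi> i")
      case True
      then have "red c = c" using less.prems by (auto simp: red_def vec_eq_iff)
      then show ?thesis by simp
    next
      case False
      then obtain i where i: "\<pi> i \<le> c $ i" by (auto simp: not_less)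
      define s where "s = c - axis i (\<pi> i)"
      have s: "0 \<le> s $ j" "s $ j \<le> c $ j" for j using i less.prems(1)[of j] \<pi>(1)[of i] by (auto simp: s_def axis_def)
      have "(\<Sum>i\<in>UNIV. s $ i) < (\<Sum>i\<in>UNIV. c $ i)"
        by (rule sum_strict_mono_ex1) (use s \<pi>(1)[of i] in \<open>auto simp: s_def axis_def intro!: exI[of _ i]\<close>)
      moreover have "0 \<le> (\<Sum>i\<in>UNIV. s $ i)" by (rule sum_nonneg) (use s in auto)
      ultimately have smaller: "nat (\<Sum>i\<in>UNIV. s $ i) < nat (\<Sum>i\<in>UNIV. c $ i)" by linarith
      have s2: "s $ j \<le> 2 * int n" for j using s(2)[of j] less.prems(2)[of j] by linarith
      have "red s = red c" unfolding red_def s_def by (auto simp: vec_eq_iff axis_def)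
      then have "pat m x (t1 + s) = pat m x (t1 + red c)" using less.hyps[OF smaller s(1) s2] by simp
      moreover have "pat m x (t1 + s) = pat m x ((t1 + axis i (\<pi> i)) + s)"
      proof (rule det_vec)
        show "t1 \<in> S" using t1S[of 0] by simp
        show "t1 + axis i (\<pi> i) \<in> S"
          by (rule t1S) (use \<pi>(1)[of i] \<pi>(2)[of i] pn in \<open>auto simp: axis_def\<close>)
        show "t1 + s \<in> S" by (rule t1S) (use s s2 in auto)
        show "t1 + axis i (\<pi> i) + s \<in> S" using t1S[OF less.prems] by (simp add: s_def)
      qed (use \<pi>(3) s in auto)
      ultimately show ?thesis by (simp add: s_def)
    qed
  qed
  have xy: "x (t1 + 1 + c) = y c" if "\<And>i. 0 \<le> c $ i" "\<And>i. c $ i \<le> 2 * int n" for c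
  proof -
    have "red c $ i \<le> 2 * int n" for i using redn(2)[of c i] \<pi>(2)[of i] pn by linarith
    then have "t1 + red c \<in> S" by (intro t1S redn(1))
    \<comment> \<open>If \<open>m\<close> is 0, \<open>pat m\<close> sees no letter at all; a
      pattern of size \<open>Suc m\<close> always contains the letter at offset 1.\<close>
    then have "pat (Suc m) x (t1 + c) = pat (Suc m) x (t1 + red c)"
      using main[OF that] t1S[OF that] det by blast
    moreover have "(1 :: int ^ 'd) \<in> cube (Suc m)" by (simp add: cube_def)
    ultimately have "x (t1 + c + 1) = x (t1 + red c + 1)" unfolding pat_eq_iff by blast
    then show ?thesis by (simp add: y_def add_ac)
  qed
  \<comment> \<open>Reduced offsets are below \<open>n\<close>, so the window has coordinates up to
    \<open>2 * n\<close>, where \<open>xy\<close> identifies \<open>y\<close> with \<open>x\<close>.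
    Hence every \<open>n\<close>-pattern of \<open>y\<close> occurs in \<open>x\<close>.\<close>
  have "pat n y q = pat n x (t1 + 1 + red q)" for q
    unfolding pat_eq_iff
  proof
    fix a :: "int ^ 'd" assume a: "a \<in> cube n"
    have "0 \<le> (red q + a) $ i \<and> (red q + a) $ i \<le> 2 * int n" for i
    proof -
      have "1 \<le> a $ i" "a $ i \<le> int n" using a by (auto simp: cube_def)
      then show ?thesis using redn[of q i] \<pi>(2)[of i] pn by simp
    qed
    then have "x (t1 + 1 + (red q + a)) = y (red q + a)" by (intro xy) auto
    also have "red (red q + a) = red (q + a)" by (simp add: red_def vec_eq_iff mod_simps)
    then have "y (red q + a) = y (q + a)" by (simp add: y_def)
    finally show "y (q + a) = x (t1 + 1 + red q + a)" by (simp add: add_ac)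
  qed
  then have "y \<in> SFT A n \<omega>" using x unfolding SFT_iff by (auto simp: y_def)
  then show ?thesis
    by (rule periodic_imp_finite_orbit[where \<pi> = \<pi>, rotated 2]) (use \<pi>(1) in \<open>auto simp: y_def red_def\<close>)
qed

section \<open>Counting blocks of low complexity\<close>

text \<open>Balls of the sup norm. The radius is an integer since windows shrink by subtraction; a
  negative radius gives the empty ball.\<close>

definition sball :: "int \<Rightarrow> (int ^ 'd::finite) set" where
  "sball r = {z. \<forall>i. \<bar>z $ i\<bar> \<le> r}"

lemma sball_eq: "sball r = {z. \<forall>i. - r \<le> z $ i \<and> z $ i \<le> r}"
  unfolding sball_def abs_le_iff by (auto simp: minus_le_iff)

lemma finite_sball: "finite (sball r)"
  unfolding sball_eq by (rule finite_int_box)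

lemma card_sball:
  assumes "0 \<le> r" shows "card (sball r :: (int ^ 'd::finite) set) = (nat (2 * r + 1)) ^ CARD('d)"
proof -
  have "int (card (sball r :: (int ^ 'd) set)) = (\<Prod>i\<in>(UNIV::'d set). r - - r + 1)"
    unfolding sball_eq by (rule card_int_box) (use assms in simp)
  then have "int (card (sball r :: (int ^ 'd) set)) = int ((nat (2 * r + 1)) ^ CARD('d))"
    using assms by (simp add: algebra_simps)
  then show ?thesis by (simp only: of_nat_eq_iff)
qed

lemma sball_add: "u \<in> sball r \<Longrightarrow> v \<in> sball s \<Longrightarrow> r + s \<le> t \<Longrightarrow> u + v \<in> sball t"
  unfolding sball_def by (simp, meson abs_triangle_ineq add_mono order_trans)

lemma sball_minus_iff: "- u \<in> sball r \<longleftrightarrow> u \<in> sball r"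
  by (simp add: sball_def)

lemma sball_diff: "u \<in> sball r \<Longrightarrow> v \<in> sball s \<Longrightarrow> r + s \<le> t \<Longrightarrow> u - v \<in> sball t"
  using sball_add[of u r "- v" s t] by (simp add: sball_minus_iff)

lemma sball_mono: "r \<le> s \<Longrightarrow> u \<in> sball r \<Longrightarrow> u \<in> sball s"
  unfolding sball_def by (simp, meson order_trans)

text \<open>If \<open>x\<close> looks the same on the balls of radius \<open>w\<close> around
  \<open>z\<close> and \<open>z'\<close> for each pair of \<open>G\<close>, these are pairs of
  positions forced to carry equal letters.\<close>

definition glue :: "int \<Rightarrow> ((int ^ 'd) \<times> (int ^ 'd)) set \<Rightarrow> ((int ^ 'd::finite) \<times> (int ^ 'd)) set" where
  "glue w G = {(z + b, z' + b) | z z' b. (z, z') \<in> G \<and> b \<in> sball w}"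

lemma glueI: "(z, z') \<in> G \<Longrightarrow> b \<in> sball w \<Longrightarrow> (z + b, z' + b) \<in> glue w G"
  unfolding glue_def by blast

lemma glue_mono: "G \<subseteq> H \<Longrightarrow> glue w G \<subseteq> glue w H"
  unfolding glue_def by blast

lemma glue_sound:
  assumes "(c, d) \<in> (glue w G)\<^sup>*" "\<And>z z' b. (z, z') \<in> G \<Longrightarrow> b \<in> sball w \<Longrightarrow> x (z + b) = x (z' + b)"
  shows "x c = x d"
  using assms(1)
proof (induction rule: rtrancl_induct)
  case (step y z)
  then show ?case using assms(2) unfolding glue_def by auto
qed simp

text \<open>Local periods near \<open>z\<close>: a dyadic net of \<open>4\<^sup>d\<close> periods on each of the scales \<open>R, R div 2, \<dots>\<close>
  generates them all, by paths that stay close to \<open>z\<close>.\<close>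

lemma local_periods_net:
  fixes x :: "('a, 'd::finite) config" and R :: int
  assumes "0 \<le> R" "R < 2 ^ l"
  shows "\<exists>S. finite S \<and> card S \<le> 4 ^ CARD('d) * l \<and> S \<subseteq> sball R \<and>
    (\<forall>u\<in>S. \<forall>b\<in>sball (W - 2 * R). x (z + u + b) = x (z + b)) \<and>
    (\<forall>v\<in>sball R. \<forall>E w. \<forall>e\<in>sball E. (\<forall>b\<in>sball W. x (z + v + b) = x (z + b)) \<longrightarrow> E + 2 * R \<le> w \<longrightarrow>
      (z + e, z + e + v) \<in> (glue w ((\<lambda>u. (z, z + u)) ` S))\<^sup>*)"
  using assms
proof (induction l arbitrary: R W)
  case 0
  then have "R = 0" by simp
  then have v: "sball R = {0 :: int ^ 'd}" by (auto simp: sball_def vec_eq_iff)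
  show ?case unfolding v by (rule exI[of _ "{}"]) auto
next
  case (Suc l)
  \<comment> \<open>One level of the net brings a period of size up to \<open>R\<close> within
    \<open>R div 2\<close> of a chosen one; the difference is left to the induction hypothesis, on a
    window shrunk by \<open>R\<close>.\<close>
  define R' where "R' = R div 2"
  have R': "0 \<le> R'" "R' < 2 ^ l" "2 * R' \<le> R" "R \<le> 2 * R' + 1" using Suc.prems by (auto simp: R'_def)
  from Suc.IH[OF R'(1,2), of "W - R"] obtain S where
    IH: "finite S \<and> card S \<le> 4 ^ CARD('d) * l \<and> S \<subseteq> sball R' \<and>
      (\<forall>u\<in>S. \<forall>b\<in>sball (W - R - 2 * R'). x (z + u + b) = x (z + b)) \<and>
      (\<forall>v\<in>sball R'. \<forall>E w. \<forall>e\<in>sball E. (\<forall>b\<in>sball (W - R). x (z + v + b) = x (z + b)) \<longrightarrow> E + 2 * R' \<le> w \<longrightarrow>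
        (z + e, z + e + v) \<in> (glue w ((\<lambda>u. (z, z + u)) ` S))\<^sup>*)" ..
  note S = IH[THEN conjunct1] IH[THEN conjunct2, THEN conjunct1]
    IH[THEN conjunct2, THEN conjunct2, THEN conjunct1]
    IH[THEN conjunct2, THEN conjunct2, THEN conjunct2, THEN conjunct1, rule_format]
    IH[THEN conjunct2, THEN conjunct2, THEN conjunct2, THEN conjunct2, THEN bspec, THEN spec, THEN spec, THEN bspec, THEN mp, THEN mp]
  define V where "V = {v \<in> sball R. \<forall>b\<in>sball W. x (z + v + b) = x (z + b)}"
  \<comment> \<open>In each coordinate, \<open>- R\<close> to \<open>R\<close> is covered by four
    intervals of length \<open>R' + 1\<close>; \<open>rep\<close> keeps one period from each
    nonempty class.\<close>
  define \<kappa> :: "int ^ 'd \<Rightarrow> int ^ 'd" where "\<kappa> v = (\<chi> i. (v $ i + R) div (R' + 1))" for v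
  define rep where "rep q = (SOME v. v \<in> V \<and> \<kappa> v = q)" for q
  define S0 where "S0 = rep ` \<kappa> ` V"
  have rep: "rep (\<kappa> v) \<in> V" "\<kappa> (rep (\<kappa> v)) = \<kappa> v" if "v \<in> V" for v
    using someI_ex[of "\<lambda>u. u \<in> V \<and> \<kappa> u = \<kappa> v"] that unfolding rep_def by blast+
  have finV: "finite V" unfolding V_def by (rule finite_subset[OF _ finite_sball[of R]]) auto
  have S0: "S0 \<subseteq> V" unfolding S0_def using rep by blast
  have "\<kappa> ` V \<subseteq> {q. \<forall>i. 0 \<le> q $ i \<and> q $ i \<le> 3}"
  proof clarify
    fix v i assume "v \<in> V"
    then have "\<bar>v $ i\<bar> \<le> R" by (simp add: V_def sball_def)
    then have "v $ i \<le> R" "- R \<le> v $ i" by (simp_all add: abs_le_iff)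
    then have b: "0 \<le> v $ i + R" "v $ i + R < 4 * (R' + 1)" using R'(3,4) by simp_all
    have "0 \<le> (v $ i + R) div (R' + 1)" using b R'(1) by (simp add: pos_imp_zdiv_nonneg_iff)
    moreover have "(v $ i + R) div (R' + 1) * (R' + 1) < 4 * (R' + 1)"
    proof -
      have "0 \<le> (v $ i + R) mod (R' + 1)" using R'(1) by (intro pos_mod_sign) simp
      then show ?thesis unfolding minus_mod_eq_div_mult[symmetric] using b(2) by linarith
    qed
    then have "(v $ i + R) div (R' + 1) < 4" using R'(1) by (simp only: mult_less_cancel_right)
    ultimately show "0 \<le> \<kappa> v $ i \<and> \<kappa> v $ i \<le> 3" by (simp add: \<kappa>_def)
  qed
  then have "card (\<kappa> ` V) \<le> card {q :: int ^ 'd. \<forall>i. 0 \<le> q $ i \<and> q $ i \<le> 3}"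
    by (intro card_mono finite_int_box)
  also have "\<dots> = 4 ^ CARD('d)"
    using card_int_box[of "\<lambda>_::'d. 0" "\<lambda>_. 3"] by (simp flip: of_nat_eq_iff)
  finally have cardS0: "card S0 \<le> 4 ^ CARD('d)"
    unfolding S0_def using card_image_le[of "\<kappa> ` V" rep] finV by auto
  let ?g = "\<lambda>u. (z, z + u)"
  show ?case
  proof (intro exI[of _ "S0 \<union> S"] conjI ballI allI impI)
    show "finite (S0 \<union> S)" using S0 finV S(1) finite_subset by blast
    show "card (S0 \<union> S) \<le> 4 ^ CARD('d) * Suc l"
      using card_Un_le[of S0 S] cardS0 S(2) by simp
    show "S0 \<union> S \<subseteq> sball R"
      using S0 S(3) R' sball_mono[of R' R] by (auto simp: V_def)
    show "x (z + u + b) = x (z + b)" if "u \<in> S0 \<union> S" "b \<in> sball (W - 2 * R)" for u b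
    proof (cases "u \<in> S0")
      case True
      moreover have "b \<in> sball W" using that(2) by (rule sball_mono[rotated]) (use Suc.prems in simp)
      ultimately show ?thesis using S0 by (auto simp: V_def)
    next
      case False
      moreover have "b \<in> sball (W - R - 2 * R')" using that(2) by (rule sball_mono[rotated]) (use R' in simp)
      ultimately show ?thesis using S(4) that(1) by blast
    qed
    fix v e :: "int ^ 'd" and E w :: int
    assume v: "v \<in> sball R" and e: "e \<in> sball E" and per: "\<forall>b\<in>sball W. x (z + v + b) = x (z + b)"
      and w: "E + 2 * R \<le> w"
    have vV: "v \<in> V" using v per by (simp add: V_def)
    define u where "u = rep (\<kappa> v)"
    have u: "u \<in> V" "\<kappa> u = \<kappa> v" unfolding u_def using rep vV by blast+
    have uS0: "u \<in> S0" using vV by (simp add: S0_def u_def)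
    have ub: "u \<in> sball R" using u by (simp add: V_def)
    have "\<bar>v $ i - u $ i\<bar> \<le> R'" for i
    proof -
      have eq: "(v $ i + R) div (R' + 1) = (u $ i + R) div (R' + 1)" using u(2) by (simp add: \<kappa>_def vec_eq_iff)
      have "v $ i - u $ i = (v $ i + R) mod (R' + 1) - (u $ i + R) mod (R' + 1)"
        unfolding minus_div_mult_eq_mod[symmetric] eq by simp
      moreover have "0 \<le> (v $ i + R) mod (R' + 1)" "(v $ i + R) mod (R' + 1) < R' + 1"
        "0 \<le> (u $ i + R) mod (R' + 1)" "(u $ i + R) mod (R' + 1) < R' + 1"
        using R'(1) by (intro pos_mod_sign pos_mod_bound; simp)+
      ultimately show ?thesis by linarith
    qed
    then have vu: "v - u \<in> sball R'" by (simp add: sball_def)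
    have eu: "e + u \<in> sball (E + R)" using e ub by (rule sball_add) simp
    \<comment> \<open>Two periods on \<open>sball W\<close> are compared at an argument moved by
      \<open>u\<close>, which has size at most \<open>R\<close>; this costs \<open>R\<close> of the
      window.\<close>
    have "\<forall>b\<in>sball (W - R). x (z + (v - u) + b) = x (z + b)"
    proof
      fix b :: "int ^ 'd" assume "b \<in> sball (W - R)"
      then have "b - u \<in> sball W" by (rule sball_diff[OF _ ub]) simp
      then have "x (z + v + (b - u)) = x (z + (b - u))" "x (z + u + (b - u)) = x (z + (b - u))"
        using per u(1) by (auto simp: V_def)
      then show "x (z + (v - u) + b) = x (z + b)" by (simp add: algebra_simps)
    qed
    \<comment> \<open>The path passes through \<open>e + u\<close>, and
      \<open>E + R + 2 * R' \<le> E + 2 * R \<le> w\<close>.\<close>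
    then have "(z + (e + u), z + (e + u) + (v - u)) \<in> (glue w (?g ` S))\<^sup>*"
      by (intro S(5)[OF vu eu]) (use w R' in auto)
    then have "(z + e + u, z + e + v) \<in> (glue w (?g ` S))\<^sup>*" by (simp add: algebra_simps)
    then have "(z + u + e, z + e + v) \<in> (glue w (?g ` S))\<^sup>*" by (simp only: add_ac)
    then have "(z + u + e, z + e + v) \<in> (glue w (?g ` (S0 \<union> S)))\<^sup>*"
      using rtrancl_mono[OF glue_mono[of "?g ` S" "?g ` (S0 \<union> S)"]] by blast
    moreover have "(z + e, (z + u) + e) \<in> glue w (?g ` (S0 \<union> S))"
    proof (rule glueI)
      show "(z, z + u) \<in> ?g ` (S0 \<union> S)" using uS0 by blast
      show "e \<in> sball w" by (rule sball_mono[OF _ e]) (use w Suc.prems in simp)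
    qed
    ultimately show "(z + e, z + e + v) \<in> (glue w (?g ` (S0 \<union> S)))\<^sup>*"
      by (rule converse_rtrancl_into_rtrancl[rotated])
  qed
qed

text \<open>Equality of large patterns is generated by few pairs: cut the ball into cells of side \<open>k\<close> and take
  one pair of equal patterns for each pair of cells. Any other such pair with centres in the same cells
  differs from it by a local period.\<close>

lemma twin_generators:
  fixes x :: "('a, 'd::finite) config" and \<rho> k h :: int and a l :: nat
  defines "J \<equiv> (2 * a + 3) ^ CARD('d)"
  assumes k: "1 \<le> k" "13 * k \<le> h" "2 * k < 2 ^ l" and \<rho>: "0 \<le> \<rho>" "\<rho> div k \<le> int a"
  shows "\<exists>G. G \<noteq> {} \<and> finite G \<and> card G \<le> J * J + J * (4 ^ CARD('d) * l) \<and>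
    G \<subseteq> sball (\<rho> + 3 * k) \<times> sball (\<rho> + 3 * k) \<and>
    (\<forall>z z'. (z, z') \<in> G \<longrightarrow> (\<forall>b\<in>sball (6 * k). x (z + b) = x (z' + b))) \<and>
    (\<forall>c\<in>sball \<rho>. \<forall>c'\<in>sball \<rho>. (\<forall>b\<in>sball h. x (c + b) = x (c' + b)) \<longrightarrow> (c, c') \<in> (glue (6 * k) G)\<^sup>*)"
proof -
  define \<kappa> :: "int ^ 'd \<Rightarrow> int ^ 'd" where "\<kappa> c = (\<chi> i. c $ i div k)" for c
  define corner :: "int ^ 'd \<Rightarrow> int ^ 'd" where "corner Q = (\<chi> i. k * Q $ i)" for Q
  define twin where "twin c c' \<longleftrightarrow> (\<forall>b\<in>sball h. x (c + b) = x (c' + b))" for c c'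
  define K where "K = \<kappa> ` sball \<rho>"
  have finK: "finite K" unfolding K_def using finite_sball by blast
  \<comment> \<open>Rounding down at the negative end costs one, hence \<open>a + 1\<close> and at
    most \<open>2 * a + 3\<close> cell indices per axis.\<close>
  have K_sub: "K \<subseteq> sball (int a + 1)"
    unfolding K_def
  proof clarify
    fix c :: "int ^ 'd" assume c: "c \<in> sball \<rho>"
    have "\<bar>c $ i div k\<bar> \<le> int a + 1" for i
    proof -
      have "- \<rho> \<le> c $ i" "c $ i \<le> \<rho>" using c by (auto simp: sball_eq)
      then have "c $ i div k \<le> \<rho> div k" "(- \<rho>) div k \<le> c $ i div k" using k(1) by (auto intro: zdiv_mono1)
      moreover have "- (\<rho> div k) - 1 \<le> (- \<rho>) div k"
        using k(1) by (simp add: zdiv_zminus1_eq_if)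
      ultimately show ?thesis using \<rho>(2) by linarith
    qed
    then show "\<kappa> c \<in> sball (int a + 1)" by (simp add: sball_def \<kappa>_def)
  qed
  have cardK: "card K \<le> J"
  proof -
    have "card K \<le> card (sball (int a + 1) :: (int ^ 'd) set)" by (rule card_mono[OF finite_sball K_sub])
    also have "\<dots> = J" unfolding J_def by (subst card_sball) (auto simp: nat_add_distrib nat_mult_distrib algebra_simps)
    finally show ?thesis .
  qed
  have cell: "c - corner (\<kappa> c) \<in> sball (k - 1)" for c
  proof -
    have "\<bar>c $ i - k * (c $ i div k)\<bar> \<le> k - 1" for i
    proof -
      have "c $ i - k * (c $ i div k) = c $ i mod k" by (simp add: minus_mult_div_eq_mod)
      moreover have "0 \<le> c $ i mod k" "c $ i mod k < k" using k(1) by simp_all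
      ultimately show ?thesis by simp
    qed
    then show ?thesis by (simp add: sball_def corner_def \<kappa>_def)
  qed
  have same_cell: "c - b \<in> sball k" if "\<kappa> c = \<kappa> b" for c b
  proof -
    have "\<bar>c $ i - b $ i\<bar> \<le> k" for i
    proof -
      have "c $ i div k = b $ i div k" using that by (simp add: \<kappa>_def vec_eq_iff)
      then have "c $ i - b $ i = c $ i mod k - b $ i mod k"
        unfolding minus_mult_div_eq_mod[symmetric] by simp
      moreover have "0 \<le> c $ i mod k" "c $ i mod k < k" "0 \<le> b $ i mod k" "b $ i mod k < k" using k(1) by simp_all
      ultimately show ?thesis by linarith
    qed
    then show ?thesis by (simp add: sball_def)
  qed
  \<comment> \<open>The errors to be corrected have size at most \<open>2 * k\<close> and are
    periods on radius \<open>h - 3 * k\<close>. The generators then hold on radius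
    \<open>h - 7 * k\<close>, at least \<open>6 * k\<close> by \<open>13 * k \<le> h\<close>; and
    \<open>6 * k\<close> is \<open>E + 2 * (2 * k)\<close> for \<open>E = 2 * k\<close>.\<close>
  have "\<forall>Q. \<exists>S. finite S \<and> card S \<le> 4 ^ CARD('d) * l \<and> S \<subseteq> sball (2 * k) \<and>
    (\<forall>u\<in>S. \<forall>b\<in>sball (h - 3 * k - 2 * (2 * k)). x (corner Q + u + b) = x (corner Q + b)) \<and>
    (\<forall>v\<in>sball (2 * k). \<forall>E w. \<forall>e\<in>sball E. (\<forall>b\<in>sball (h - 3 * k). x (corner Q + v + b) = x (corner Q + b)) \<longrightarrow>
      E + 2 * (2 * k) \<le> w \<longrightarrow>
      (corner Q + e, corner Q + e + v) \<in> (glue w ((\<lambda>u. (corner Q, corner Q + u)) ` S))\<^sup>*)"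
    using k by (intro allI local_periods_net) auto
  then obtain S where "\<forall>Q. finite (S Q) \<and> card (S Q) \<le> 4 ^ CARD('d) * l \<and> S Q \<subseteq> sball (2 * k) \<and>
    (\<forall>u\<in>S Q. \<forall>b\<in>sball (h - 3 * k - 2 * (2 * k)). x (corner Q + u + b) = x (corner Q + b)) \<and>
    (\<forall>v\<in>sball (2 * k). \<forall>E w. \<forall>e\<in>sball E. (\<forall>b\<in>sball (h - 3 * k). x (corner Q + v + b) = x (corner Q + b)) \<longrightarrow>
      E + 2 * (2 * k) \<le> w \<longrightarrow>
      (corner Q + e, corner Q + e + v) \<in> (glue w ((\<lambda>u. (corner Q, corner Q + u)) ` S Q))\<^sup>*)"
    unfolding choice_iff ..
  note S = this[rule_format, THEN conjunct1] this[rule_format, THEN conjunct2, THEN conjunct1]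
    this[rule_format, THEN conjunct2, THEN conjunct2, THEN conjunct1]
    this[THEN spec, THEN conjunct2, THEN conjunct2, THEN conjunct2, THEN conjunct1, rule_format]
    this[THEN spec, THEN conjunct2, THEN conjunct2, THEN conjunct2, THEN conjunct2, THEN bspec, THEN spec, THEN spec,
      THEN bspec, THEN mp, THEN mp]
  define good where "good q p \<longleftrightarrow> fst p \<in> sball \<rho> \<and> snd p \<in> sball \<rho> \<and> \<kappa> (fst p) = fst q \<and> \<kappa> (snd p) = snd q \<and>
    twin (fst p) (snd p)" for q p
  define pr where "pr q = (SOME p. good q p)" for q
  have pr: "good q (pr q)" if "good q p" for q p unfolding pr_def using that by (rule someI)
  define M where "M = {q \<in> K \<times> K. \<exists>p. good q p}"
  \<comment> \<open>\<open>G1\<close> carries a point from one cell to another up to a small error;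
    \<open>G2\<close> corrects the error by local periods around the cell corners.\<close>
  define G1 where "G1 = pr ` M"
  define G2 where "G2 = (\<Union>Q\<in>K. (\<lambda>u. (corner Q, corner Q + u)) ` S Q)"
  have MK: "M \<subseteq> K \<times> K" "finite M" using finK by (auto simp: M_def intro: finite_subset)
  have "card M \<le> card (K \<times> K)" by (rule card_mono) (use MK finK in auto)
  then have "card G1 \<le> card K * card K"
    unfolding G1_def using card_image_le[OF MK(2), of pr] by (simp add: card_cartesian_product)
  then have cardG1: "card G1 \<le> J * J" using mult_le_mono[OF cardK cardK] by linarith
  have "card G2 \<le> (\<Sum>Q\<in>K. card ((\<lambda>u. (corner Q, corner Q + u)) ` S Q))"
    unfolding G2_def by (rule card_UN_le[OF finK])
  also have "\<dots> \<le> (\<Sum>Q\<in>K. 4 ^ CARD('d) * l)"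
    by (intro sum_mono order.trans[OF card_image_le] S)
  also have "\<dots> \<le> J * (4 ^ CARD('d) * l)" using cardK by simp
  finally have cardG2: "card G2 \<le> J * (4 ^ CARD('d) * l)" .
  \<comment> \<open>The diagonal pair shows that \<open>G1\<close> is nonempty, so that a list of
    generators can be padded.\<close>
  have self: "good (\<kappa> 0, \<kappa> 0) (0, 0)" using \<rho> by (simp add: good_def twin_def sball_def)
  have M0: "(\<kappa> 0, \<kappa> 0) \<in> M" using self \<rho> by (auto simp: M_def K_def sball_def)
  show ?thesis
  proof (intro exI[of _ "G1 \<union> G2"] conjI ballI allI impI)
    show "G1 \<union> G2 \<noteq> {}" using M0 by (auto simp: G1_def)
    show "finite (G1 \<union> G2)" unfolding G1_def G2_def by (intro finite_UnI finite_imageI finite_UN_I MK finK S(1))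
    show "card (G1 \<union> G2) \<le> J * J + J * (4 ^ CARD('d) * l)"
      using card_Un_le[of G1 G2] cardG1 cardG2 by linarith
    have "G1 \<subseteq> sball (\<rho> + 3 * k) \<times> sball (\<rho> + 3 * k)"
    proof
      fix p assume "p \<in> G1"
      then obtain q where "good q p" using pr unfolding G1_def M_def by blast
      then have "fst p \<in> sball \<rho>" "snd p \<in> sball \<rho>" by (auto simp: good_def)
      then show "p \<in> sball (\<rho> + 3 * k) \<times> sball (\<rho> + 3 * k)"
        using k(1) sball_mono[of \<rho> "\<rho> + 3 * k"] unfolding mem_Times_iff by auto
    qed
    moreover have "G2 \<subseteq> sball (\<rho> + 3 * k) \<times> sball (\<rho> + 3 * k)"
    proof
      fix p assume "p \<in> G2"
      then obtain c u where c: "c \<in> sball \<rho>" and u: "u \<in> S (\<kappa> c)" and p: "p = (corner (\<kappa> c), corner (\<kappa> c) + u)"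
        by (auto simp: G2_def K_def)
      have "corner (\<kappa> c) = c - (c - corner (\<kappa> c))" by simp
      then have "corner (\<kappa> c) \<in> sball (\<rho> + k)" using sball_diff[OF c cell[of c], of "\<rho> + k"] by simp
      moreover from this have "corner (\<kappa> c) + u \<in> sball (\<rho> + 3 * k)"
        by (rule sball_add) (use u S(3) in auto)
      ultimately show "p \<in> sball (\<rho> + 3 * k) \<times> sball (\<rho> + 3 * k)"
        using k(1) sball_mono[of "\<rho> + k" "\<rho> + 3 * k"] by (auto simp: p)
    qed
    ultimately show "G1 \<union> G2 \<subseteq> sball (\<rho> + 3 * k) \<times> sball (\<rho> + 3 * k)" by blast
  next
    fix z z' b :: "int ^ 'd" assume z: "(z, z') \<in> G1 \<union> G2" and b: "b \<in> sball (6 * k)"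
    show "x (z + b) = x (z' + b)"
    proof (cases "(z, z') \<in> G1")
      case True
      then obtain q p where "q \<in> M" "(z, z') = pr q" by (auto simp: G1_def)
      then have "good q (z, z')" using pr by (auto simp: M_def)
      moreover have "b \<in> sball h" by (rule sball_mono[OF _ b]) (use k in linarith)
      ultimately show ?thesis by (simp add: good_def twin_def)
    next
      case False
      then obtain Q u where "u \<in> S Q" "z = corner Q" "z' = corner Q + u" using z by (auto simp: G2_def)
      moreover have "b \<in> sball (h - 3 * k - 2 * (2 * k))" by (rule sball_mono[OF _ b]) (use k in linarith)
      ultimately show ?thesis using S(4) by simp
    qed
  next
    fix c c' :: "int ^ 'd" assume c: "c \<in> sball \<rho>" "c' \<in> sball \<rho>" and tw: "\<forall>b\<in>sball h. x (c + b) = x (c' + b)"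
    have gcc: "good (\<kappa> c, \<kappa> c') (c, c')" using c tw by (simp add: good_def twin_def)
    have inM: "(\<kappa> c, \<kappa> c') \<in> M" using c gcc by (auto simp: M_def K_def)
    obtain b b' where bb: "pr (\<kappa> c, \<kappa> c') = (b, b')" by fastforce
    have g: "good (\<kappa> c, \<kappa> c') (b, b')" using pr[OF gcc] bb by simp
    have cb: "c - b \<in> sball k" "c' - b' \<in> sball k" using g same_cell by (auto simp: good_def)
    let ?z = "corner (\<kappa> c')"
    \<comment> \<open>\<open>c2\<close> is where the chosen pair \<open>(b, b')\<close> sends
      \<open>c\<close>. The surroundings of \<open>c2\<close> and of \<open>c'\<close> both look
      like those of \<open>c\<close>, so the difference \<open>v\<close> is a local period.\<close>
    define c2 where "c2 = b' + (c - b)"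
    define v where "v = c' - c2"
    have "(b + (c - b), b' + (c - b)) \<in> glue (6 * k) (G1 \<union> G2)"
    proof (rule glueI)
      show "(b, b') \<in> G1 \<union> G2" using inM bb by (metis G1_def UnI1 imageI)
      show "c - b \<in> sball (6 * k)" by (rule sball_mono[OF _ cb(1)]) (use k in linarith)
    qed
    then have step1: "(c, c2) \<in> glue (6 * k) (G1 \<union> G2)" by (simp add: c2_def)
    have v: "v \<in> sball (2 * k)"
    proof -
      have "v = (c' - b') - (c - b)" by (simp add: v_def c2_def)
      then show ?thesis using sball_diff[OF cb(2,1), of "2 * k"] by simp
    qed
    have b'z: "b' - ?z \<in> sball (k - 1)" using cell[of b'] g by (simp add: good_def)
    have e: "c2 - ?z \<in> sball (2 * k)"
    proof -
      from b'z have "(b' - ?z) + (c - b) \<in> sball (2 * k)" by (rule sball_add[OF _ cb(1)]) simp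
      moreover have "(b' - ?z) + (c - b) = c2 - ?z" by (simp add: c2_def algebra_simps)
      ultimately show ?thesis by simp
    qed
    have per: "\<forall>y\<in>sball (h - 3 * k). x (?z + v + y) = x (?z + y)"
    proof
      fix y :: "int ^ 'd" assume y: "y \<in> sball (h - 3 * k)"
      define s where "s = y - (c2 - ?z)"
      have s: "s \<in> sball (h - k)" unfolding s_def by (rule sball_diff[OF y e]) simp
      have sh: "s \<in> sball h" by (rule sball_mono[OF _ s]) (use k in linarith)
      have "c - b + s \<in> sball h" by (rule sball_add[OF cb(1) s]) simp
      moreover have "twin b b'" using g by (simp add: good_def)
      ultimately have "x (b + (c - b + s)) = x (b' + (c - b + s))" unfolding twin_def by blast
      moreover have "b + (c - b + s) = c + s" "b' + (c - b + s) = ?z + y"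
        by (simp_all add: s_def c2_def algebra_simps)
      moreover have "x (c + s) = x (c' + s)" using tw sh by blast
      moreover have "c' + s = ?z + v + y" by (simp add: s_def v_def algebra_simps)
      ultimately show "x (?z + v + y) = x (?z + y)" by simp
    qed
    have "(?z + (c2 - ?z), ?z + (c2 - ?z) + v) \<in> (glue (6 * k) ((\<lambda>u. (?z, ?z + u)) ` S (\<kappa> c')))\<^sup>*"
      by (rule S(5)[OF v e per]) simp
    moreover have "?z + (c2 - ?z) = c2" "?z + (c2 - ?z) + v = c'" by (simp_all add: v_def)
    moreover have "(glue (6 * k) ((\<lambda>u. (?z, ?z + u)) ` S (\<kappa> c')))\<^sup>* \<subseteq> (glue (6 * k) (G1 \<union> G2))\<^sup>*"
    proof (intro rtrancl_mono glue_mono)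
      have "\<kappa> c' \<in> K" using c by (simp add: K_def)
      then show "(\<lambda>u. (?z, ?z + u)) ` S (\<kappa> c') \<subseteq> G1 \<union> G2" unfolding G2_def by blast
    qed
    ultimately have "(c2, c') \<in> (glue (6 * k) (G1 \<union> G2))\<^sup>*" by auto
    with step1 show "(c, c') \<in> (glue (6 * k) (G1 \<union> G2))\<^sup>*" by (rule converse_rtrancl_into_rtrancl)
  qed
qed

text \<open>The labellings are sorted by \<open>g\<close>. A set \<open>D\<close> of representatives
  depends on the relation \<open>\<rho> g\<close> alone, so labellings with the same
  \<open>g\<close> are determined by their restrictions to one common \<open>D\<close>.\<close>

lemma card_le_labellings:
  fixes \<rho> :: "'g \<Rightarrow> ('c \<times> 'c) set"
  assumes fin: "finite L" "finite B" "finite A" and "A \<noteq> {}" and U: "U \<subseteq> B \<rightarrow>\<^sub>E A"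
    and ex: "\<And>u. u \<in> U \<Longrightarrow> \<exists>g\<in>L. (\<exists>D\<subseteq>B. card D \<le> N \<and> (\<forall>c\<in>B. \<exists>d\<in>D. (c, d) \<in> \<rho> g)) \<and>
      (\<forall>c\<in>B. \<forall>d\<in>B. (c, d) \<in> \<rho> g \<longrightarrow> u c = u d)"
  shows "card U \<le> card L * card A ^ N"
proof -
  define reps where "reps g D \<longleftrightarrow> D \<subseteq> B \<and> card D \<le> N \<and> (\<forall>c\<in>B. \<exists>d\<in>D. (c, d) \<in> \<rho> g)" for g D
  define V where "V g = {u \<in> U. (\<exists>D. reps g D) \<and> (\<forall>c\<in>B. \<forall>d\<in>B. (c, d) \<in> \<rho> g \<longrightarrow> u c = u d)}" for g
  have finU: "finite U" using U fin by (meson finite_PiE finite_subset)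
  have "U \<subseteq> (\<Union>g\<in>L. V g)"
  proof
    fix u assume "u \<in> U"
    from ex[OF this] obtain g D where "g \<in> L" "D \<subseteq> B" "card D \<le> N" "\<forall>c\<in>B. \<exists>d\<in>D. (c, d) \<in> \<rho> g"
      "\<forall>c\<in>B. \<forall>d\<in>B. (c, d) \<in> \<rho> g \<longrightarrow> u c = u d" by auto
    then show "u \<in> (\<Union>g\<in>L. V g)" using \<open>u \<in> U\<close> unfolding V_def reps_def by blast
  qed
  then have "card U \<le> card (\<Union>g\<in>L. V g)"
    by (intro card_mono finite_UN_I fin) (use finU in \<open>auto simp: V_def\<close>)
  also have "\<dots> \<le> (\<Sum>g\<in>L. card (V g))" by (rule card_UN_le[OF fin(1)])
  also have "\<dots> \<le> (\<Sum>g\<in>L. card A ^ N)"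
  proof (rule sum_mono)
    fix g assume "g \<in> L"
    show "card (V g) \<le> card A ^ N"
    proof (cases "\<exists>D. reps g D")
      case False
      then have "V g = {}" by (simp add: V_def)
      then show ?thesis by simp
    next
      case True
      then obtain D where D: "D \<subseteq> B" "card D \<le> N" "\<And>c. c \<in> B \<Longrightarrow> \<exists>d\<in>D. (c, d) \<in> \<rho> g" by (auto simp: reps_def)
      have finD: "finite D" using D fin finite_subset by blast
      have "inj_on (\<lambda>u. restrict u D) (V g)"
      proof (rule inj_onI)
        fix u v assume u: "u \<in> V g" and v: "v \<in> V g" and eq: "restrict u D = restrict v D"
        have "u c = v c" if "c \<in> B" for c
        proof -
          obtain d where d: "d \<in> D" "(c, d) \<in> \<rho> g" using D(3)[OF \<open>c \<in> B\<close>] by blast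
          then have "u c = u d" "v c = v d" using u v that D(1) by (auto simp: V_def)
          moreover have "u d = v d" using fun_cong[OF eq, of d] d by simp
          ultimately show ?thesis by simp
        qed
        moreover have "u \<in> B \<rightarrow>\<^sub>E A" "v \<in> B \<rightarrow>\<^sub>E A" using u v U by (auto simp: V_def)
        ultimately show "u = v" by (intro PiE_ext) auto
      qed
      moreover have "(\<lambda>u. restrict u D) ` V g \<subseteq> D \<rightarrow>\<^sub>E A"
      proof clarify
        fix u assume "u \<in> V g"
        then have "u \<in> B \<rightarrow>\<^sub>E A" using U by (auto simp: V_def)
        then show "restrict u D \<in> D \<rightarrow>\<^sub>E A" using D(1) by auto
      qed
      ultimately have "card (V g) \<le> card (D \<rightarrow>\<^sub>E A)"
        by (intro card_inj_on_le finite_PiE finD fin(3)) auto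
      also have "\<dots> = card A ^ card D" using finD by (simp add: card_PiE)
      also have "\<dots> \<le> card A ^ N"
        using fin(3) \<open>A \<noteq> {}\<close> D(2) by (intro power_increasing) (auto simp: Suc_le_eq card_gt_0_iff)
      finally show ?thesis .
    qed
  qed
  finally show ?thesis by simp
qed

text \<open>Turns generator sets into lists of one fixed length, which are easy to count.\<close>

lemma pad_list:
  assumes "finite G" "G \<noteq> {}" "card G \<le> g"
  shows "\<exists>xs. set xs = G \<and> length xs = g"
proof -
  obtain ys where ys: "set ys = G" "distinct ys" using finite_distinct_list[OF assms(1)] by blast
  obtain a where a: "a \<in> G" using assms(2) by blast
  have "length ys \<le> g" using ys assms(3) distinct_card by fastforce
  then show ?thesis using ys a by (intro exI[of _ "ys @ replicate (g - length ys) a"]) auto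
qed

text \<open>A block is determined by a list of generators and one letter for each
  \<open>n\<close>-pattern that occurs. \<open>h\<close> is the radius of the largest ball fitting
  in \<open>cube n\<close>; cells have side \<open>h div 13\<close>, which is positive by
  \<open>27 \<le> n\<close>.\<close>

lemma card_low_complexity_blocks:
  fixes A :: "'a set" and n r l a N :: nat
  defines "J \<equiv> (2 * a + 3) ^ CARD('d::finite)"
  defines "h \<equiv> (int n - 1) div 2"
  assumes A: "finite A" "A \<noteq> {}" and n: "27 \<le> n" "n < 2 ^ l" and a: "(int r + int n) div (h div 13) \<le> int a"
  shows "card {restrict x (sball (int (r + n))) | x :: ('a, 'd) config. range x \<subseteq> A \<and>
      card (pat n x ` sball (int (r + 2 * n))) \<le> N}
    \<le> ((2 * (r + 2 * n) + 1) ^ (2 * CARD('d))) ^ (J * J + J * (4 ^ CARD('d) * l)) * card A ^ N"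
    (is "card ?U \<le> _")
proof -
  define k where "k = h div 13"
  define g where "g = J * J + J * (4 ^ CARD('d) * l)"
  have h: "13 \<le> h" "2 * h + 1 \<le> int n" using n(1) by (auto simp: h_def)
  have k: "1 \<le> k" "13 * k \<le> h" using h by (auto simp: k_def)
  have nl: "int n < 2 ^ l" using n(2) by (metis of_nat_less_iff of_nat_numeral of_nat_power)
  have k2: "2 * k < 2 ^ l" using nl k h by linarith
  let ?B = "sball (int (r + n)) :: (int ^ 'd) set"
  let ?Z = "sball (int (r + 2 * n)) :: (int ^ 'd) set"
  let ?L = "{xs. set xs \<subseteq> ?Z \<times> ?Z \<and> length xs = g}"
  have "card ?U \<le> card ?L * card A ^ N"
  proof (rule card_le_labellings[where B = ?B and \<rho> = "\<lambda>xs. (glue (6 * k) (set xs))\<^sup>*"])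
    show "finite ?L" by (intro finite_lists_length_eq finite_cartesian_product finite_sball)
    show "?U \<subseteq> ?B \<rightarrow>\<^sub>E A" by auto
    fix u assume "u \<in> ?U"
    then obtain x :: "('a, 'd) config" where u: "u = restrict x ?B" and x: "range x \<subseteq> A" "card (pat n x ` ?Z) \<le> N" by blast
    have "\<exists>G. G \<noteq> {} \<and> finite G \<and> card G \<le> J * J + J * (4 ^ CARD('d) * l) \<and>
      G \<subseteq> sball (int (r + n) + 3 * k) \<times> sball (int (r + n) + 3 * k) \<and>
      (\<forall>z z'. (z, z') \<in> G \<longrightarrow> (\<forall>b\<in>sball (6 * k). x (z + b) = x (z' + b))) \<and>
      (\<forall>c\<in>?B. \<forall>c'\<in>?B. (\<forall>b\<in>sball h. x (c + b) = x (c' + b)) \<longrightarrow> (c, c') \<in> (glue (6 * k) G)\<^sup>*)"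
      unfolding J_def by (rule twin_generators) (use k k2 a in \<open>auto simp: k_def\<close>)
    then obtain G where "G \<noteq> {} \<and> finite G \<and> card G \<le> J * J + J * (4 ^ CARD('d) * l) \<and>
      G \<subseteq> sball (int (r + n) + 3 * k) \<times> sball (int (r + n) + 3 * k) \<and>
      (\<forall>z z'. (z, z') \<in> G \<longrightarrow> (\<forall>b\<in>sball (6 * k). x (z + b) = x (z' + b))) \<and>
      (\<forall>c\<in>?B. \<forall>c'\<in>?B. (\<forall>b\<in>sball h. x (c + b) = x (c' + b)) \<longrightarrow> (c, c') \<in> (glue (6 * k) G)\<^sup>*)" ..
    note G = this[THEN conjunct1] this[THEN conjunct2, THEN conjunct1]
      this[THEN conjunct2, THEN conjunct2, THEN conjunct1, folded g_def]
      this[THEN conjunct2, THEN conjunct2, THEN conjunct2, THEN conjunct1]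
      this[THEN conjunct2, THEN conjunct2, THEN conjunct2, THEN conjunct2, THEN conjunct1, rule_format]
      this[THEN conjunct2, THEN conjunct2, THEN conjunct2, THEN conjunct2, THEN conjunct2, THEN bspec, THEN bspec, THEN mp]
    obtain xs where xs: "set xs = G" "length xs = g" using pad_list[OF G(2,1,3)] by blast
    have "sball (int (r + n) + 3 * k) \<subseteq> ?Z"
      using k h sball_mono[of "int (r + n) + 3 * k" "int (r + 2 * n)"] by auto
    then have "xs \<in> ?L" using xs G(4) by auto
    moreover
    \<comment> \<open>The shift by \<open>h + 1\<close> places the ball of radius \<open>h\<close>
      around \<open>c\<close> inside the cube of the pattern, as cubes start at 1.\<close>
    define \<phi> where "\<phi> c = pat n x (c - (\<chi> i. h + 1))" for c
    define rep where "rep w = (SOME c. c \<in> ?B \<and> \<phi> c = w)" for w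
    have rep: "rep (\<phi> c) \<in> ?B" "\<phi> (rep (\<phi> c)) = \<phi> c" if "c \<in> ?B" for c
      using someI_ex[of "\<lambda>c'. c' \<in> ?B \<and> \<phi> c' = \<phi> c"] that unfolding rep_def by blast+
    have "\<phi> ` ?B \<subseteq> pat n x ` ?Z"
    proof clarify
      fix c :: "int ^ 'd" assume c: "c \<in> ?B"
      have "(\<chi> i. h + 1) \<in> (sball (h + 1) :: (int ^ 'd) set)" using h by (simp add: sball_def)
      then have "c - (\<chi> i. h + 1) \<in> ?Z" by (rule sball_diff[OF c]) (use h in auto)
      then show "\<phi> c \<in> pat n x ` ?Z" unfolding \<phi>_def by blast
    qed
    then have "card (rep ` \<phi> ` ?B) \<le> N"
      using x(2) card_image_le[of "\<phi> ` ?B" rep] card_mono[of "pat n x ` ?Z" "\<phi> ` ?B"] finite_sball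
      by (meson finite_imageI order_trans)
    moreover have rel: "(c, rep (\<phi> c)) \<in> (glue (6 * k) G)\<^sup>*" if "c \<in> ?B" for c
    proof (rule G(6))
      define c' where "c' = rep (\<phi> c)"
      have "\<phi> c = \<phi> c'" using rep(2)[OF that] by (simp add: c'_def)
      then have eq: "pat n x (c - (\<chi> i. h + 1)) = pat n x (c' - (\<chi> i. h + 1))" by (simp only: \<phi>_def)
      have "\<forall>b\<in>sball h. x (c + b) = x (c' + b)"
      proof
        fix b :: "int ^ 'd" assume b: "b \<in> sball h"
        have "1 \<le> b $ i + (h + 1) \<and> b $ i + (h + 1) \<le> int n" for i
        proof -
          have "- h \<le> b $ i" "b $ i \<le> h" using b by (auto simp: sball_eq)
          then show ?thesis using h by linarith
        qed
        then have "b + (\<chi> i. h + 1) \<in> cube n" by (simp add: cube_def)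
        with eq have "x (c - (\<chi> i. h + 1) + (b + (\<chi> i. h + 1))) = x (c' - (\<chi> i. h + 1) + (b + (\<chi> i. h + 1)))"
          unfolding pat_eq_iff by blast
        then show "x (c + b) = x (c' + b)" by simp
      qed
      then show "\<forall>b\<in>sball h. x (c + b) = x (rep (\<phi> c) + b)" by (simp only: c'_def)
    qed (use rep that in auto)
    moreover have "u c = u d" if "c \<in> ?B" "d \<in> ?B" "(c, d) \<in> (glue (6 * k) G)\<^sup>*" for c d
    proof -
      have "x c = x d" using that(3) by (rule glue_sound) (use G(5) in blast)
      then show ?thesis using that by (simp add: u)
    qed
    moreover have "rep ` \<phi> ` ?B \<subseteq> ?B" using rep(1) by blast
    moreover have "\<forall>c\<in>?B. \<exists>d\<in>rep ` \<phi> ` ?B. (c, d) \<in> (glue (6 * k) G)\<^sup>*" using rel by blast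
    ultimately have "(\<exists>D\<subseteq>?B. card D \<le> N \<and> (\<forall>c\<in>?B. \<exists>d\<in>D. (c, d) \<in> (glue (6 * k) (set xs))\<^sup>*)) \<and>
      (\<forall>c\<in>?B. \<forall>d\<in>?B. (c, d) \<in> (glue (6 * k) (set xs))\<^sup>* \<longrightarrow> u c = u d)" "xs \<in> ?L"
      unfolding xs(1) by blast+
    then show "\<exists>xs\<in>?L. (\<exists>D\<subseteq>?B. card D \<le> N \<and> (\<forall>c\<in>?B. \<exists>d\<in>D. (c, d) \<in> (glue (6 * k) (set xs))\<^sup>*)) \<and>
      (\<forall>c\<in>?B. \<forall>d\<in>?B. (c, d) \<in> (glue (6 * k) (set xs))\<^sup>* \<longrightarrow> u c = u d)" ..
  qed (rule finite_sball A)+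
  also have "card ?L = (card (?Z \<times> ?Z)) ^ g"
    by (rule card_lists_length_eq) (intro finite_cartesian_product finite_sball)
  also have "card (?Z \<times> ?Z) = (2 * (r + 2 * n) + 1) ^ (2 * CARD('d))"
  proof -
    have "nat (2 * int (r + 2 * n) + 1) = 2 * (r + 2 * n) + 1" by linarith
    then have "card ?Z = (2 * (r + 2 * n) + 1) ^ CARD('d)"
      using card_sball[of "int (r + 2 * n)", where 'd = 'd] by (simp only: of_nat_0_le_iff)
    then show ?thesis by (simp only: card_cartesian_product mult_2[of "CARD('d)"] power_add)
  qed
  finally show ?thesis by (simp only: g_def)
qed

section \<open>The subcritical case\<close>

lemma prob_pair_pmf_Times:
  "measure_pmf.prob (pair_pmf M N) (A \<times> B) = measure_pmf.prob M A * measure_pmf.prob N B"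
proof -
  \<comment> \<open>The product rule used is stated for countable sets, so the events are cut down
    to the supports.\<close>
  have "measure_pmf.prob (pair_pmf M N) (A \<times> B) =
      measure_pmf.prob (pair_pmf M N) ((A \<inter> set_pmf M) \<times> (B \<inter> set_pmf N))"
    by (rule measure_prob_cong_0) (auto simp: set_pmf_iff pmf_pair)
  also have "\<dots> = measure_pmf.prob M (A \<inter> set_pmf M) * measure_pmf.prob N (B \<inter> set_pmf N)"
    by (intro measure_pmf_prob_product countable_Int2 countable_set_pmf)
  finally show ?thesis by (simp add: measure_Int_set_pmf)
qed

lemma prob_Pi_bernoulli_all:
  assumes "finite I" "S \<subseteq> I" "0 \<le> \<alpha>" "\<alpha> \<le> 1"
  shows "measure_pmf.prob (Pi_pmf I False (\<lambda>_. bernoulli_pmf \<alpha>)) {f. \<forall>s\<in>S. f s} = \<alpha> ^ card S"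
proof -
  have "{f. \<forall>s\<in>S. f s} = Pi I (\<lambda>s. if s \<in> S then {True} else UNIV)"
    using assms(2) by (auto simp: Pi_def)
  then have "measure_pmf.prob (Pi_pmf I False (\<lambda>_. bernoulli_pmf \<alpha>)) {f. \<forall>s\<in>S. f s} =
      (\<Prod>s\<in>I. measure_pmf.prob (bernoulli_pmf \<alpha>) (if s \<in> S then {True} else UNIV))"
    using assms(1) by (simp add: measure_Pi_pmf_Pi)
  also have "\<dots> = (\<Prod>s\<in>I. if s \<in> S then \<alpha> else 1)"
    using assms(3,4) by (intro prod.cong) (auto simp: measure_pmf_single)
  also have "\<dots> = \<alpha> ^ card S"
    unfolding prod.inter_restrict[OF assms(1), symmetric] Int_absorb1[OF assms(2)] by simp
  finally show ?thesis .
qed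

text \<open>Disjoint blocks are independent: splitting \<open>I\<close> into \<open>S j\<close> and
  its complement \<open>K\<close> turns the measure into a product, and the blocks inside
  \<open>K\<close> are handled by induction.\<close>

lemma prob_Pi_bernoulli_no_block:
  assumes "finite F" "finite I" "0 \<le> \<alpha>" "\<alpha> \<le> 1" "\<And>i. i \<in> F \<Longrightarrow> S i \<subseteq> I" "disjoint_family_on S F"
  shows "measure_pmf.prob (Pi_pmf I False (\<lambda>_. bernoulli_pmf \<alpha>)) {f. \<forall>i\<in>F. \<exists>s\<in>S i. \<not> f s} =
    (\<Prod>i\<in>F. 1 - \<alpha> ^ card (S i))"
  using assms(1,2,5,6)
proof (induction F arbitrary: I rule: finite_induct)
  case (insert j F)
  let ?\<mu> = "\<lambda>I. Pi_pmf I False (\<lambda>_. bernoulli_pmf \<alpha>)"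
  let ?E = "{f. \<forall>i\<in>F. \<exists>s\<in>S i. \<not> f s}" and ?G = "{f. \<exists>s\<in>S j. \<not> f s}"
  define K where "K = I - S j"
  have SF: "S i \<subseteq> K" if "i \<in> F" for i
  proof -
    have "i \<noteq> j" using that insert.hyps(2) by blast
    then have "S i \<inter> S j = {}" using disjoint_family_onD[OF insert.prems(3), of i j] that by simp
    moreover have "S i \<subseteq> I" by (rule insert.prems(2)) (use that in simp)
    ultimately show ?thesis unfolding K_def by blast
  qed
  have I: "I = K \<union> S j" using insert.prems(2) by (auto simp: K_def)
  have fin: "finite K" "finite (S j)" using insert.prems(1) unfolding I by auto
  have disj: "K \<inter> S j = {}" by (auto simp: K_def)
  define merge where "merge = (\<lambda>(f, g) x. if x \<in> K then f x else (g x :: bool))"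
  have "measure_pmf.prob (?\<mu> I) {f. \<forall>i\<in>insert j F. \<exists>s\<in>S i. \<not> f s} =
     measure_pmf.prob (pair_pmf (?\<mu> K) (?\<mu> (S j))) (merge -` {f. \<forall>i\<in>insert j F. \<exists>s\<in>S i. \<not> f s})"
    unfolding I Pi_pmf_union[OF fin disj] merge_def by simp
  also have "merge -` {f. \<forall>i\<in>insert j F. \<exists>s\<in>S i. \<not> f s} = ?E \<times> ?G"
  proof -
    have e1: "(\<exists>s\<in>S i. \<not> merge (f, g) s) \<longleftrightarrow> (\<exists>s\<in>S i. \<not> f s)" if "i \<in> F" for i f g
      using SF[OF that] unfolding merge_def by auto
    have e2: "(\<exists>s\<in>S j. \<not> merge (f, g) s) \<longleftrightarrow> (\<exists>s\<in>S j. \<not> g s)" for f g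
      using disj unfolding merge_def by auto
    have "(\<forall>i\<in>insert j F. \<exists>s\<in>S i. \<not> merge (f, g) s) \<longleftrightarrow>
        (\<exists>s\<in>S j. \<not> g s) \<and> (\<forall>i\<in>F. \<exists>s\<in>S i. \<not> f s)" for f g
    proof -
      have ins: "(\<forall>i\<in>insert j F. Q i) \<longleftrightarrow> Q j \<and> (\<forall>i\<in>F. Q i)" for Q by blast
      show ?thesis unfolding ins e2 by (intro conj_cong refl ball_cong e1)
    qed
    then have "(f, g) \<in> merge -` {f. \<forall>i\<in>insert j F. \<exists>s\<in>S i. \<not> f s} \<longleftrightarrow> (f, g) \<in> ?E \<times> ?G" for f g
      by (simp only: vimage_eq mem_Collect_eq mem_Sigma_iff conj_commute)
    then show ?thesis by (intro set_eqI) (simp only: split_paired_all)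
  qed
  also have "measure_pmf.prob (pair_pmf (?\<mu> K) (?\<mu> (S j))) (?E \<times> ?G) =
      measure_pmf.prob (?\<mu> K) ?E * measure_pmf.prob (?\<mu> (S j)) ?G"
    by (rule prob_pair_pmf_Times)
  also have "measure_pmf.prob (?\<mu> K) ?E = (\<Prod>i\<in>F. 1 - \<alpha> ^ card (S i))"
    by (rule insert.IH[OF fin(1) SF]) (use insert.prems(3) in \<open>auto simp: disjoint_family_on_def\<close>)
  also have "?G = space (measure_pmf (?\<mu> (S j))) - {f. \<forall>s\<in>S j. f s}" by auto
  also have "measure_pmf.prob (?\<mu> (S j)) \<dots> = 1 - \<alpha> ^ card (S j)"
    by (subst measure_pmf.prob_compl) (use prob_Pi_bernoulli_all[OF fin(2) order.refl assms(3,4)] in simp_all)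
  finally show ?case using insert.hyps by (simp add: mult.commute)
qed simp

lemma prob_random_patterns:
  "measure_pmf.prob (random_patterns A n \<alpha>) E =
    measure_pmf.prob (Pi_pmf (patterns A n) False (\<lambda>_. bernoulli_pmf \<alpha>)) {f. {w \<in> patterns A n. f w} \<in> E}"
  unfolding random_patterns_def by (simp add: vimage_def)

lemma prob_random_patterns_superset:
  assumes "finite A" "0 \<le> \<alpha>" "\<alpha> \<le> 1" "S \<subseteq> patterns A n"
  shows "measure_pmf.prob (random_patterns A n \<alpha>) {\<omega>. S \<subseteq> \<omega>} = \<alpha> ^ card S"
proof -
  have "{f. {w \<in> patterns A n. f w} \<in> {\<omega>. S \<subseteq> \<omega>}} = {f. \<forall>s\<in>S. f s}" using assms(4) by auto
  then show ?thesis
    unfolding prob_random_patterns using prob_Pi_bernoulli_all[OF finite_patterns[OF assms(1)] assms(4,2,3)] by simp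
qed

lemma prob_random_patterns_no_block:
  assumes "finite A" "0 \<le> \<alpha>" "\<alpha> \<le> 1" "finite F" "\<And>i. i \<in> F \<Longrightarrow> S i \<subseteq> patterns A n" "disjoint_family_on S F"
  shows "measure_pmf.prob (random_patterns A n \<alpha>) {\<omega>. \<forall>i\<in>F. \<not> S i \<subseteq> \<omega>} = (\<Prod>i\<in>F. 1 - \<alpha> ^ card (S i))"
proof -
  have "{f. {w \<in> patterns A n. f w} \<in> {\<omega>. \<forall>i\<in>F. \<not> S i \<subseteq> \<omega>}} = {f. \<forall>i\<in>F. \<exists>s\<in>S i. \<not> f s}"
    using assms(5) by fast
  then show ?thesis
    unfolding prob_random_patterns
    using prob_Pi_bernoulli_no_block[OF assms(4) finite_patterns[OF assms(1)] assms(2,3,5,6)] by simp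
qed

lemma pat_in_patterns: "range x \<subseteq> A \<Longrightarrow> pat n x t \<in> patterns A n"
  by (auto simp: pat_def patterns_def shift_def)

text \<open>The block of radius \<open>r + n\<close> suffices to decide which patterns occur at
  positions within \<open>r\<close>.\<close>

lemma pat_restrict_sball:
  fixes t :: "int ^ 'd::finite"
  assumes "t \<in> sball (int r)" shows "pat n (restrict x (sball (int (r + n)))) t = pat n x t"
  unfolding pat_eq_iff
proof
  fix a :: "int ^ 'd" assume a: "a \<in> cube n"
  have "\<bar>a $ i\<bar> \<le> int n" for i
  proof -
    have "1 \<le> a $ i" "a $ i \<le> int n" using a by (auto simp: cube_def)
    then show ?thesis by simp
  qed
  then have "a \<in> sball (int n)" by (simp add: sball_def)
  then have "t + a \<in> sball (int (r + n))" by (intro sball_add[OF assms]) auto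
  then show "restrict x (sball (int (r + n))) (t + a) = x (t + a)" by simp
qed

text \<open>Otherwise \<open>N\<close> starts at 1 or more and gains a factor above
  \<open>1 + \<delta>\<close> in each of \<open>L\<close> steps.\<close>

lemma growth_stops:
  fixes N :: "nat \<Rightarrow> nat" and \<delta> :: real
  assumes "0 < N 0" "0 < \<delta>" "N L < (1 + \<delta>) ^ L"
  shows "\<exists>i<L. real (N (Suc i)) \<le> (1 + \<delta>) * N i"
proof (rule ccontr)
  assume "\<not> ?thesis"
  then have step: "(1 + \<delta>) * N i < N (Suc i)" if "i < L" for i using that by (auto simp: not_le)
  have "i \<le> L \<Longrightarrow> (1 + \<delta>) ^ i \<le> N i" for i
  proof (induction i)
    case (Suc i)
    then have "(1 + \<delta>) ^ Suc i \<le> (1 + \<delta>) * N i" using assms(2) by (simp add: mult_left_mono)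
    then show ?case using step[of i] Suc.prems by simp
  qed (use assms(1) in simp)
  from this[of L] show False using assms(3) by simp
qed

text \<open>The Morse--Hedlund argument gives more than \<open>n\<close> patterns in the ball of
  radius \<open>3 * n\<close>, while the number of positions bounds \<open>N L\<close> polynomially.
  Steps of \<open>2 * n\<close> match the margin in
  \<open>card_low_complexity_blocks\<close>.\<close>

lemma slow_growth_stage:
  fixes x :: "('a, 'd::finite) config" and n L :: nat and \<delta> :: real
  defines "N \<equiv> \<lambda>i. card (pat n x ` sball (int (3 * n + 2 * n * i)))"
  assumes x: "x \<in> SFT A n \<omega>" and no: "\<nexists>\<gamma>. finite_orbit (SFT A n \<omega>) \<gamma>"
    and \<delta>: "0 < \<delta>" "real ((2 * (3 * n + 2 * n * L) + 1) ^ CARD('d)) < (1 + \<delta>) ^ L"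
  shows "\<exists>i<L. n < N i \<and> real (N (Suc i)) \<le> (1 + \<delta>) * N i"
proof -
  have fin: "finite (pat n x ` sball r)" for r using finite_sball by blast
  have "n < card (pat n x ` {t. \<forall>i. 0 \<le> t $ i \<and> t $ i \<le> 3 * int n})"
    using low_complexity_imp_finite_orbit[OF x] no by (meson not_le)
  also have "\<dots> \<le> N 0"
    unfolding N_def by (intro card_mono fin image_mono) (auto simp: sball_eq intro: order.trans[rotated])
  finally have N0: "n < N 0" .
  have mono: "N 0 \<le> N i" for i
    unfolding N_def by (intro card_mono fin image_mono subsetI) (erule sball_mono[rotated], simp)
  have "N L \<le> card (sball (int (3 * n + 2 * n * L)) :: (int ^ 'd) set)"
    unfolding N_def by (rule card_image_le[OF finite_sball])
  also have "\<dots> = (2 * (3 * n + 2 * n * L) + 1) ^ CARD('d)"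
  proof -
    have "nat (2 * int (3 * n + 2 * n * L) + 1) = 2 * (3 * n + 2 * n * L) + 1" by linarith
    then show ?thesis by (subst card_sball) simp_all
  qed
  finally have "real (N L) < (1 + \<delta>) ^ L" using \<delta>(2) by (meson of_nat_le_iff order.strict_trans1)
  then obtain i where "i < L" "real (N (Suc i)) \<le> (1 + \<delta>) * N i"
    using growth_stops[of N \<delta> L] N0 \<delta>(1) by auto
  moreover have "n < N i" using N0 mono[of i] by linarith
  ultimately show ?thesis by blast
qed

text \<open>A union bound over the stage \<open>i\<close> of slow growth, the number
  \<open>j > n\<close> of patterns there, and the block \<open>u\<close> showing them. At most
  \<open>M\<close> times \<open>card A\<close> to the power \<open>(1 + \<delta>) * j\<close>
  blocks, each allowed with probability \<open>\<alpha> ^ j\<close>, contribute at most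
  \<open>M * \<theta> ^ n\<close>.\<close>

lemma prob_aperiodic_le:
  fixes A :: "'a set" and n L l a :: nat and \<alpha> \<delta> \<theta> :: real
  defines "J \<equiv> (2 * a + 3) ^ CARD('d::finite)"
    and "B \<equiv> (2 * (3 * n + 2 * n * L) + 1) ^ CARD('d)"
    and "R \<equiv> 3 * n + 2 * n * L"
  assumes A: "finite A" "A \<noteq> {}" and \<alpha>: "0 \<le> \<alpha>" "\<alpha> \<le> 1" and n: "27 \<le> n" "n < 2 ^ l"
    and \<delta>: "0 < \<delta>" "real B < (1 + \<delta>) ^ L"
    and a: "(int R + int n) div ((int n - 1) div 2 div 13) \<le> int a"
    and \<theta>: "\<alpha> * real (card A) powr (1 + \<delta>) \<le> \<theta>" "\<theta> \<le> 1"
  shows "measure_pmf.prob (random_patterns A n \<alpha>) (aperiodic_event A n :: ('a, 'd) config set set)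
    \<le> real (L * B * ((2 * (R + 2 * n) + 1) ^ (2 * CARD('d))) ^ (J * J + J * (4 ^ CARD('d) * l))) * \<theta> ^ n"
proof -
  define q where "q = card A"
  define G where "G = J * J + J * (4 ^ CARD('d) * l)"
  define M where "M = ((2 * (R + 2 * n) + 1) ^ (2 * CARD('d))) ^ G"
  let ?P = "random_patterns A n \<alpha> :: ('a, 'd) config set pmf"
  have q: "1 \<le> q" using A by (simp add: q_def Suc_le_eq card_gt_0_iff)
  have "0 \<le> \<alpha> * real (card A) powr (1 + \<delta>)" using \<alpha>(1) by simp
  then have \<theta>0: "0 \<le> \<theta>" using \<theta>(1) by linarith
  define r where "r i = 3 * n + 2 * n * i" for i
  define U where "U i j = {restrict x (sball (int (r i + n))) | x :: ('a, 'd) config. range x \<subseteq> A \<and>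
    card (pat n x ` sball (int (r i))) = j \<and> real (card (pat n x ` sball (int (r (Suc i))))) \<le> (1 + \<delta>) * real j}" for i j
  define V where "V i u = {\<omega>. pat n u ` sball (int (r i)) \<subseteq> \<omega>}" for i and u :: "('a, 'd) config"
  have r_le: "r i \<le> R" if "i < L" for i using that by (simp add: r_def R_def)
  have rS: "r (Suc i) = r i + 2 * n" for i by (simp add: r_def)
  have U_sub: "U i j \<subseteq> sball (int (r i + n)) \<rightarrow>\<^sub>E A" for i j by (auto simp: U_def)
  have finU: "finite (U i j)" for i j
    by (rule finite_subset[OF U_sub]) (intro finite_PiE finite_sball A)
  have cardU: "real (card (U i j)) \<le> M * (real q powr (1 + \<delta>)) ^ j" if "i < L" for i j
  proof -
    define N where "N = nat \<lfloor>(1 + \<delta>) * real j\<rfloor>"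
    let ?W = "{restrict x (sball (int (r i + n))) | x :: ('a, 'd) config. range x \<subseteq> A \<and>
      card (pat n x ` sball (int (r i + 2 * n))) \<le> N}"
    have "?W \<subseteq> sball (int (r i + n)) \<rightarrow>\<^sub>E A" by auto
    then have finW: "finite ?W" by (rule finite_subset) (intro finite_PiE finite_sball A)
    have "U i j \<subseteq> ?W" unfolding U_def rS N_def using le_nat_floor by blast
    then have "card (U i j) \<le> card ?W" by (rule card_mono[OF finW])
    also have "\<dots> \<le> ((2 * (r i + 2 * n) + 1) ^ (2 * CARD('d))) ^ G * q ^ N"
      unfolding G_def J_def q_def
    proof (rule card_low_complexity_blocks[OF A n])
      have "0 \<le> (int n - 1) div 2 div 13" using n by simp
      then have "(int (r i) + int n) div ((int n - 1) div 2 div 13) \<le> (int R + int n) div ((int n - 1) div 2 div 13)"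
        using r_le[OF that] n(1) by (intro zdiv_mono1) auto
      then show "(int (r i) + int n) div ((int n - 1) div 2 div 13) \<le> int a" using a by linarith
    qed
    also have "\<dots> \<le> M * q ^ N"
      unfolding M_def using r_le[OF that] by (intro mult_right_mono power_mono) auto
    finally have "real (card (U i j)) \<le> real (M * q ^ N)" by (simp only: of_nat_le_iff)
    also have "real (q ^ N) = real q powr real N" using q by (simp add: powr_realpow)
    then have "real (M * q ^ N) = real M * real q powr real N" by simp
    also have "real q powr real N \<le> real q powr ((1 + \<delta>) * real j)"
      using q \<delta>(1) by (intro powr_mono) (auto simp: N_def)
    also have "\<dots> = (real q powr (1 + \<delta>)) ^ j" using q powr_realpow[of "real q powr (1 + \<delta>)" j] by (simp add: powr_powr)
    finally show ?thesis by (simp only: mult_left_mono of_nat_0_le_iff)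
  qed
  have probV: "measure_pmf.prob ?P (V i u) = \<alpha> ^ j" if uU: "u \<in> U i j" for i j u
  proof -
    obtain x where x: "u = restrict x (sball (int (r i + n)))" "range x \<subseteq> A" "card (pat n x ` sball (int (r i))) = j"
      using uU unfolding U_def by blast
    have eq: "pat n u ` sball (int (r i)) = pat n x ` sball (int (r i))"
      unfolding x(1) by (intro image_cong refl pat_restrict_sball)
    have "pat n x ` sball (int (r i)) \<subseteq> patterns A n" using pat_in_patterns[OF x(2)] by blast
    then show ?thesis unfolding V_def eq using prob_random_patterns_superset[OF A(1) \<alpha>] x(3) by metis
  qed
  have "aperiodic_event A n \<subseteq> (\<Union>i<L. \<Union>j\<in>{n<..B}. \<Union>u\<in>U i j. V i u)"
  proof
    fix \<omega> :: "('a, 'd) config set" assume "\<omega> \<in> aperiodic_event A n"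
    then obtain x where x: "x \<in> SFT A n \<omega>" and no: "\<nexists>\<gamma>. finite_orbit (SFT A n \<omega>) \<gamma>"
      unfolding aperiodic_event_def by blast
    obtain i where i: "i < L" "n < card (pat n x ` sball (int (r i)))"
      "real (card (pat n x ` sball (int (r (Suc i))))) \<le> (1 + \<delta>) * card (pat n x ` sball (int (r i)))"
      using slow_growth_stage[OF x no \<delta>(1), of L] \<delta>(2) unfolding B_def r_def by blast
    define j where "j = card (pat n x ` sball (int (r i)))"
    define u where "u = restrict x (sball (int (r i + n)))"
    have rx: "range x \<subseteq> A" "range (pat n x) \<subseteq> \<omega>" using x by (auto simp: SFT_iff)
    \<comment> \<open>There are no more patterns than positions, so \<open>j\<close> ranges up to
      \<open>B\<close>.\<close>
    have "j \<le> card (sball (int (r i)) :: (int ^ 'd) set)" unfolding j_def by (rule card_image_le[OF finite_sball])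
    also have "\<dots> = (2 * r i + 1) ^ CARD('d)"
    proof -
      have "nat (2 * int (r i) + 1) = 2 * r i + 1" by linarith
      then show ?thesis by (subst card_sball) simp_all
    qed
    also have "\<dots> \<le> B" unfolding B_def using r_le[OF i(1)] by (intro power_mono) (auto simp: R_def)
    finally have "j \<in> {n<..B}" using i(2) by (simp add: j_def)
    moreover have "u \<in> U i j" unfolding U_def u_def using rx(1) i(3) by (auto simp: j_def)
    moreover have "\<omega> \<in> V i u"
      unfolding V_def u_def using rx(2) pat_restrict_sball[of _ "r i" n x] by auto
    ultimately show "\<omega> \<in> (\<Union>i<L. \<Union>j\<in>{n<..B}. \<Union>u\<in>U i j. V i u)" using i(1) by blast
  qed
  then have "measure_pmf.prob ?P (aperiodic_event A n) \<le> measure_pmf.prob ?P (\<Union>i<L. \<Union>j\<in>{n<..B}. \<Union>u\<in>U i j. V i u)"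
    by (intro measure_pmf.finite_measure_mono) auto
  also have "\<dots> \<le> (\<Sum>i<L. measure_pmf.prob ?P (\<Union>j\<in>{n<..B}. \<Union>u\<in>U i j. V i u))"
    by (intro measure_UNION_le) auto
  also have "\<dots> \<le> (\<Sum>i<L. \<Sum>j\<in>{n<..B}. measure_pmf.prob ?P (\<Union>u\<in>U i j. V i u))"
    by (intro sum_mono measure_UNION_le) auto
  also have "\<dots> \<le> (\<Sum>i<L. \<Sum>j\<in>{n<..B}. \<Sum>u\<in>U i j. measure_pmf.prob ?P (V i u))"
    by (intro sum_mono measure_UNION_le finU) auto
  also have "\<dots> = (\<Sum>i<L. \<Sum>j\<in>{n<..B}. real (card (U i j)) * \<alpha> ^ j)"
    by (intro sum.cong refl) (simp add: probV)
  also have "\<dots> \<le> (\<Sum>i<L. \<Sum>j\<in>{n<..B}. real M * \<theta> ^ n)"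
  proof (intro sum_mono)
    fix i j assume ij: "i \<in> {..<L}" "j \<in> {n<..B}"
    have "real (card (U i j)) * \<alpha> ^ j \<le> real M * (real q powr (1 + \<delta>)) ^ j * \<alpha> ^ j"
      using cardU[of i j] ij \<alpha>(1) by (intro mult_right_mono) auto
    also have "\<dots> = real M * (\<alpha> * real q powr (1 + \<delta>)) ^ j" by (simp add: power_mult_distrib)
    also have "\<dots> \<le> real M * \<theta> ^ j"
      using \<theta>(1) \<alpha>(1) by (intro mult_left_mono power_mono) (auto simp: q_def)
    also have "\<dots> \<le> real M * \<theta> ^ n"
      using \<theta>0 \<theta>(2) ij by (intro mult_left_mono power_decreasing) auto
    finally show "real (card (U i j)) * \<alpha> ^ j \<le> real M * \<theta> ^ n" .
  qed
  also have "\<dots> = real L * real (card {n<..B}) * (real M * \<theta> ^ n)" by simp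
  also have "\<dots> \<le> real L * real B * (real M * \<theta> ^ n)"
    using \<theta>0 by (intro mult_right_mono mult_left_mono) auto
  finally show ?thesis unfolding M_def G_def by (simp only: of_nat_mult mult.assoc)
qed

section \<open>Asymptotics of the block count\<close>

lemma power_div_pow2_tendsto_0: "(\<lambda>l. real l ^ k / 2 ^ l) \<longlonglongrightarrow> 0"
proof -
  \<comment> \<open>Up to a constant factor this is \<open>x ^ k / exp x\<close> along
    \<open>x = l * ln 2\<close>.\<close>
  have "((\<lambda>x. x ^ k / exp x) \<longlongrightarrow> (0::real)) at_top" by (rule tendsto_power_div_exp_0)
  moreover have "filterlim (\<lambda>l. real l * ln 2) at_top sequentially"
    by (rule filterlim_at_top_mult_tendsto_pos[of _ "ln 2"]) (auto simp: filterlim_real_sequentially)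
  ultimately have "(\<lambda>l. (real l * ln 2) ^ k / exp (real l * ln 2)) \<longlonglongrightarrow> 0" by (rule filterlim_compose)
  then have "(\<lambda>l. (1 / ln 2) ^ k * ((real l * ln 2) ^ k / exp (real l * ln 2))) \<longlonglongrightarrow> (1 / ln 2) ^ k * 0"
    by (intro tendsto_mult tendsto_const)
  moreover have "(1 / ln 2) ^ k * ((real l * ln 2) ^ k / exp (real l * ln 2)) = real l ^ k / 2 ^ l" for l
    by (simp add: power_mult_distrib power_divide exp_of_nat_mult)
  ultimately show ?thesis by simp
qed

text \<open>As \<open>l\<close> is at most the binary logarithm of \<open>2 * n\<close>, the
  exponent \<open>C * l ^ k\<close> is polylogarithmic in \<open>n\<close> and loses to the linear
  exponent of \<open>\<beta> ^ n\<close>.\<close>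

lemma subpolynomial_bound:
  fixes \<beta> :: real
  assumes "0 < \<beta>" "\<beta> < 1"
  shows "\<exists>l0. \<forall>l n. l0 \<le> l \<longrightarrow> 2 ^ l \<le> 2 * n \<longrightarrow> 2 ^ (C * l ^ k) * \<beta> ^ n \<le> 1"
proof -
  define \<kappa> where "\<kappa> = ln (1 / \<beta>)"
  have \<kappa>: "0 < \<kappa>" using assms by (simp add: \<kappa>_def)
  have "(\<lambda>l. (2 * real C * ln 2) * (real l ^ k / 2 ^ l)) \<longlonglongrightarrow> (2 * real C * ln 2) * 0"
    by (intro tendsto_mult tendsto_const power_div_pow2_tendsto_0)
  then have "\<forall>\<^sub>F l in sequentially. (2 * real C * ln 2) * (real l ^ k / 2 ^ l) < \<kappa>"
    using \<kappa> by (intro order_tendstoD) auto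
  then obtain l0 where l0: "\<And>l. l0 \<le> l \<Longrightarrow> (2 * real C * ln 2) * (real l ^ k / 2 ^ l) < \<kappa>"
    unfolding eventually_sequentially by blast
  show ?thesis
  proof (intro exI[of _ l0] allI impI)
    fix l n :: nat assume l: "l0 \<le> l" and n: "2 ^ l \<le> 2 * n"
    have "real (2 ^ l) \<le> real (2 * n)" using n by (simp only: of_nat_le_iff)
    then have n': "2 ^ l \<le> 2 * real n" by simp
    have "2 * real C * ln 2 * real l ^ k \<le> \<kappa> * 2 ^ l" using l0[OF l] by (simp add: field_simps)
    also have "\<dots> \<le> \<kappa> * (2 * real n)" using n' \<kappa> by (intro mult_left_mono) auto
    finally have "real (C * l ^ k) * ln 2 \<le> real n * \<kappa>" by (simp add: mult_ac)
    then have "exp (real (C * l ^ k) * ln 2) \<le> exp (real n * \<kappa>)" by (simp only: exp_le_cancel_iff)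
    also have "exp (real (C * l ^ k) * ln 2) = 2 ^ (C * l ^ k)" unfolding exp_of_nat_mult by simp
    also have "exp (real n * \<kappa>) = (1 / \<beta>) ^ n" unfolding exp_of_nat_mult \<kappa>_def using assms by simp
    finally have "2 ^ (C * l ^ k) * \<beta> ^ n \<le> (1 / \<beta>) ^ n * \<beta> ^ n" using assms by (intro mult_right_mono) auto
    also have "\<dots> = 1" using assms by (simp add: power_mult_distrib[symmetric])
    finally show "2 ^ (C * l ^ k) * \<beta> ^ n \<le> 1" .
  qed
qed

text \<open>All quantities are compared with powers of two. The base is at most
  \<open>2 ^ (4 * l)\<close> and the number of generators is bounded by a constant times
  \<open>l ^ (2 * d + 1)\<close>; the base supplies one more factor \<open>l\<close> in the
  exponent.\<close>

lemma block_count_le: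
  fixes c d l n :: nat
  defines "L \<equiv> c * l" and "J \<equiv> (2 * (312 * (c * l)) + 3) ^ d"
  assumes c: "1 \<le> c" "c * l \<le> 2 ^ l" and l: "2 \<le> l" and n: "1 \<le> n" "n < 2 ^ l"
  shows "(2 * (3 * n + 2 * n * L) + 1) ^ d \<le> 2 ^ (4 * d * l)" (is ?B)
    and "L * (2 * (3 * n + 2 * n * L) + 1) ^ d *
       ((2 * (3 * n + 2 * n * L + 2 * n) + 1) ^ (2 * d)) ^ (J * J + J * (4 ^ d * l))
     \<le> 2 ^ ((1 + 4 * d + 8 * d * ((627 * c) ^ (2 * d) + (627 * c) ^ d * 4 ^ d)) * l ^ (2 * d + 2))" (is ?M)
proof -
  have L: "1 \<le> L" "L \<le> 2 ^ l" using c l by (auto simp: L_def)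
  have nL: "n \<le> n * L" "1 \<le> n * L" using n L by auto
  have "2 * (3 * n + 2 * n * L + 2 * n) + 1 = 10 * n + 4 * (n * L) + 1" by (simp add: algebra_simps)
  also have "\<dots> \<le> 15 * (n * L)" using nL by linarith
  also have "\<dots> \<le> 2 ^ (2 * l) * (2 ^ l * 2 ^ l)"
  proof (intro mult_mono)
    have "(15::nat) \<le> 2 ^ 4" by simp
    also have "\<dots> \<le> 2 ^ (2 * l)" using l by (intro power_increasing) auto
    finally show "(15::nat) \<le> 2 ^ (2 * l)" .
  qed (use n L in auto)
  also have "\<dots> = 2 ^ (4 * l)" by (simp flip: power_add)
  finally have b2: "2 * (3 * n + 2 * n * L + 2 * n) + 1 \<le> 2 ^ (4 * l)" .
  then have b1: "2 * (3 * n + 2 * n * L) + 1 \<le> 2 ^ (4 * l)" 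
    by (rule order.trans[rotated]) simp
  have "(2 * (3 * n + 2 * n * L) + 1) ^ d \<le> (2 ^ (4 * l)) ^ d" by (rule power_mono[OF b1]) simp
  also have "\<dots> = 2 ^ (4 * d * l)" by (simp flip: power_mult add: mult_ac)
  finally show B: ?B .
  define G where "G = J * J + J * (4 ^ d * l)"
  define C0 where "C0 = (627 * c) ^ (2 * d) + (627 * c) ^ d * 4 ^ d"
  have cl: "1 \<le> c * l" using c l by simp
  \<comment> \<open>\<open>627 = 2 * 312 + 3\<close>, where 3 is absorbed by
    \<open>1 \<le> c * l\<close>.\<close>
  have "J \<le> (627 * (c * l)) ^ d" unfolding J_def using cl by (intro power_mono) auto
  then have J: "J \<le> (627 * c) ^ d * l ^ d" by (simp add: power_mult_distrib mult_ac)
  have "J * J \<le> ((627 * c) ^ d * l ^ d) * ((627 * c) ^ d * l ^ d)" by (rule mult_mono[OF J J]) simp_all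
  also have "\<dots> = (627 * c) ^ (2 * d) * l ^ (2 * d)" by (simp add: mult_2 power_add)
  also have "\<dots> \<le> (627 * c) ^ (2 * d) * l ^ (2 * d + 1)" using l by (intro mult_left_mono power_increasing) auto
  finally have JJ: "J * J \<le> (627 * c) ^ (2 * d) * l ^ (2 * d + 1)" .
  have "J * (4 ^ d * l) \<le> ((627 * c) ^ d * l ^ d) * (4 ^ d * l)" by (rule mult_right_mono[OF J]) simp
  also have "\<dots> = (627 * c) ^ d * 4 ^ d * l ^ (d + 1)" by simp
  also have "\<dots> \<le> (627 * c) ^ d * 4 ^ d * l ^ (2 * d + 1)" using l by (intro mult_left_mono power_increasing) auto
  finally have "G \<le> (627 * c) ^ (2 * d) * l ^ (2 * d + 1) + (627 * c) ^ d * 4 ^ d * l ^ (2 * d + 1)"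
    unfolding G_def by (rule add_mono[OF JJ])
  then have G: "G \<le> C0 * l ^ (2 * d + 1)" unfolding C0_def by (simp only: add_mult_distrib)
  have "((2 * (3 * n + 2 * n * L + 2 * n) + 1) ^ (2 * d)) ^ G \<le> ((2 ^ (4 * l)) ^ (2 * d)) ^ G"
    by (intro power_mono b2) auto
  also have "\<dots> = 2 ^ (8 * d * l * G)" by (simp flip: power_mult add: mult_ac)
  finally have M: "((2 * (3 * n + 2 * n * L + 2 * n) + 1) ^ (2 * d)) ^ G \<le> 2 ^ (8 * d * l * G)" .
  have "L * (2 * (3 * n + 2 * n * L) + 1) ^ d * ((2 * (3 * n + 2 * n * L + 2 * n) + 1) ^ (2 * d)) ^ G
      \<le> 2 ^ l * 2 ^ (4 * d * l) * 2 ^ (8 * d * l * G)"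
    by (intro mult_mono L(2) B M) simp_all
  also have "\<dots> = 2 ^ (l + 4 * d * l + 8 * d * l * G)" by (simp add: power_add)
  also have "\<dots> \<le> 2 ^ ((1 + 4 * d + 8 * d * C0) * l ^ (2 * d + 2))"
  proof (rule power_increasing)
    have ll: "l \<le> l ^ (2 * d + 2)" using power_increasing[of 1 "2 * d + 2" l] l by simp
    have "8 * d * l * G \<le> 8 * d * l * (C0 * l ^ (2 * d + 1))" by (rule mult_left_mono[OF G]) simp
    also have "\<dots> = 8 * d * C0 * l ^ (2 * d + 2)" by simp
    finally have "8 * d * l * G \<le> 8 * d * C0 * l ^ (2 * d + 2)" .
    moreover have "4 * d * l \<le> 4 * d * l ^ (2 * d + 2)" by (rule mult_left_mono[OF ll]) simp
    ultimately have "l + 4 * d * l + 8 * d * l * G \<le> l ^ (2 * d + 2) + 4 * d * l ^ (2 * d + 2) + 8 * d * C0 * l ^ (2 * d + 2)"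
      using ll by (intro add_mono) auto
    then show "l + 4 * d * l + 8 * d * l * G \<le> (1 + 4 * d + 8 * d * C0) * l ^ (2 * d + 2)"
      by (simp only: add_mult_distrib mult_1)
  qed simp
  finally show ?M unfolding G_def C0_def .
qed

text \<open>Continuity of \<open>\<alpha> * q powr (1 + \<delta>)\<close> at
  \<open>\<delta> = 0\<close> leaves room for a positive \<open>\<delta>\<close>.\<close>

lemma subcritical_exponent:
  fixes \<alpha> q :: real
  assumes "0 \<le> \<alpha>" "1 \<le> q" "\<alpha> * q < 1"
  obtains \<delta> \<theta> where "0 < \<delta>" "0 < \<theta>" "\<theta> < 1" "\<alpha> * q powr (1 + \<delta>) \<le> \<theta>"
proof -
  have "((\<lambda>\<delta>. \<alpha> * q powr (1 + \<delta>)) \<longlongrightarrow> \<alpha> * q powr (1 + 0)) (at_right 0)"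
    using assms by (intro tendsto_intros) auto
  then have "\<forall>\<^sub>F \<delta> in at_right 0. \<alpha> * q powr (1 + \<delta>) < 1"
    using assms by (intro order_tendstoD) auto
  then obtain b where b: "0 < b" "\<And>\<delta>. 0 < \<delta> \<Longrightarrow> \<delta> < b \<Longrightarrow> \<alpha> * q powr (1 + \<delta>) < 1"
    unfolding eventually_at_right_field by blast
  \<comment> \<open>The maximum with \<open>1 / 2\<close> keeps \<open>\<theta>\<close> positive
    even for \<open>\<alpha> = 0\<close>.\<close>
  show thesis
  proof (rule that[of "b / 2" "max (1 / 2) (\<alpha> * q powr (1 + b / 2))"])
    show "max (1 / 2) (\<alpha> * q powr (1 + b / 2)) < 1" using b(2)[of "b / 2"] b(1) by simp
  qed (use b(1) in auto)
qed

lemma prob_aperiodic_subcritical: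
  fixes A :: "'a set" and \<alpha> :: real
  assumes A: "finite A" "A \<noteq> {}" and \<alpha>: "0 \<le> \<alpha>" "\<alpha> \<le> 1" "\<alpha> * real (card A) < 1"
  shows "\<exists>\<beta>. 0 < \<beta> \<and> \<beta> < 1 \<and> (\<exists>n0. \<forall>n\<ge>n0.
    measure_pmf.prob (random_patterns A n \<alpha>) (aperiodic_event A n :: ('a, 'd::finite) config set set) \<le> \<beta> ^ n)"
proof -
  let ?d = "CARD('d)"
  have "1 \<le> real (card A)" using A by (simp add: Suc_le_eq card_gt_0_iff)
  then obtain \<delta> \<theta> where \<delta>: "0 < \<delta>" and \<theta>: "0 < \<theta>" "\<theta> < 1" "\<alpha> * real (card A) powr (1 + \<delta>) \<le> \<theta>"
    using subcritical_exponent[OF \<alpha>(1) _ \<alpha>(3)] by blast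
  \<comment> \<open>With this \<open>c\<close>, growth by \<open>1 + \<delta>\<close> over
    \<open>L = c * l\<close> stages would exceed the bound \<open>2 ^ (4 * CARD('d) * l)\<close> on
    the number of positions.\<close>
  obtain c where c: "2 ^ (4 * ?d) < (1 + \<delta>) ^ c" using real_arch_pow[of "1 + \<delta>"] \<delta> by auto
  have c1: "1 \<le> c"
  proof (rule ccontr)
    assume "\<not> 1 \<le> c"
    then have "c = 0" by simp
    then have "(2::real) ^ (4 * ?d) < 1" using c by simp
    moreover have "(1::real) \<le> 2 ^ (4 * ?d)" by simp
    ultimately show False by linarith
  qed
  \<comment> \<open>Half of the decay, in \<open>\<theta> ^ n = \<beta> ^ n * \<beta> ^ n\<close>,
    pays for the subexponential number of blocks.\<close>
  define \<beta> where "\<beta> = sqrt \<theta>"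
  have \<beta>: "0 < \<beta>" "\<beta> < 1" "\<beta> * \<beta> = \<theta>" using \<theta> by (auto simp: \<beta>_def)
  define C where "C = 1 + 4 * ?d + 8 * ?d * ((627 * c) ^ (2 * ?d) + (627 * c) ^ ?d * 4 ^ ?d)"
  obtain l0 where l0: "\<And>l n. l0 \<le> l \<Longrightarrow> 2 ^ l \<le> 2 * n \<Longrightarrow> 2 ^ (C * l ^ (2 * ?d + 2)) * \<beta> ^ n \<le> 1"
    using subpolynomial_bound[OF \<beta>(1,2)] by blast
  have "\<forall>\<^sub>F l in sequentially. real l ^ 1 / 2 ^ l < 1 / real c"
    using c1 by (intro order_tendstoD(2)[OF power_div_pow2_tendsto_0]) simp
  then obtain l1 where l1: "\<And>l. l1 \<le> l \<Longrightarrow> real l ^ 1 / 2 ^ l < 1 / real c"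
    unfolding eventually_sequentially by blast
  define l2 where "l2 = max 6 (max l0 l1)"
  show ?thesis
  proof (intro exI[of _ \<beta>] conjI exI[of _ "2 ^ l2"] allI impI)
    fix n :: nat assume n: "2 ^ l2 \<le> n"
    have "1 \<le> n" using n by (meson one_le_numeral one_le_power order_trans)
    then obtain l' where l': "2 ^ l' \<le> n" "n < 2 ^ (l' + 1)" using ex_power_ivl1[of 2 n] by auto
    \<comment> \<open>The number of binary digits of \<open>n\<close>, so that
      \<open>n < 2 ^ l \<le> 2 * n\<close>.\<close>
    define l where "l = l' + 1"
    have nl: "n < 2 ^ l" "2 ^ l \<le> 2 * n" using l' by (auto simp: l_def)
    have "(2::nat) ^ l2 < 2 ^ l" using n nl(1) by linarith
    then have "l2 < l" by simp
    then have l: "6 \<le> l" "l0 \<le> l" "l1 \<le> l" by (auto simp: l2_def)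
    have n64: "64 \<le> n"
    proof -
      have "(2::nat) ^ 6 \<le> 2 ^ l2" by (rule power_increasing) (auto simp: l2_def)
      then show ?thesis using n by simp
    qed
    have "real (c * l) \<le> real (2 ^ l)" using l1[OF l(3)] c1 by (simp add: field_simps)
    then have cl: "c * l \<le> 2 ^ l" by (simp only: of_nat_le_iff)
    define L where "L = c * l"
    define R where "R = 3 * n + 2 * n * L"
    define B where "B = (2 * (3 * n + 2 * n * L) + 1) ^ ?d"
    define J where "J = (2 * (312 * (c * l)) + 3) ^ ?d"
    have count: "B \<le> 2 ^ (4 * ?d * l)"
      "L * B * ((2 * (R + 2 * n) + 1) ^ (2 * ?d)) ^ (J * J + J * (4 ^ ?d * l)) \<le> 2 ^ (C * l ^ (2 * ?d + 2))"
      unfolding B_def R_def J_def L_def C_def using block_count_le[OF c1 cl _ \<open>1 \<le> n\<close> nl(1), of ?d] l(1) by simp_all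
    have "real B \<le> real (2 ^ (4 * ?d * l))" using count(1) by (simp only: of_nat_le_iff)
    also have "\<dots> = (2 ^ (4 * ?d)) ^ l" by (simp add: power_mult)
    also have "\<dots> < ((1 + \<delta>) ^ c) ^ l" using c l(1) by (intro power_strict_mono) auto
    also have "\<dots> = (1 + \<delta>) ^ L" by (simp add: L_def power_mult)
    finally have BL: "real B < (1 + \<delta>) ^ L" .
    define k where "k = (int n - 1) div 2 div 13"
    have k: "int n \<le> 52 * k" using n64 unfolding k_def by linarith
    have L1: "1 \<le> L" using c1 l(1) by (simp add: L_def)
    \<comment> \<open>The constant 312 is \<open>6 * 52\<close>, from
      \<open>R + n \<le> 6 * (n * L)\<close> and \<open>n \<le> 52 * k\<close>.\<close>
    have "(int R + int n) div k \<le> int (312 * L)"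
    proof -
      have nL: "n \<le> n * L" using L1 by simp
      have "int R + int n = int (R + n)" by simp
      also have "\<dots> \<le> int (6 * (n * L))" unfolding R_def of_nat_le_iff using nL by (simp add: algebra_simps)
      also have "\<dots> = int n * (6 * int L)" by simp
      also have "\<dots> \<le> 52 * k * (6 * int L)" by (rule mult_right_mono[OF k]) simp
      also have "\<dots> = int (312 * L) * k" by simp
      finally have "(int R + int n) div k \<le> (int (312 * L) * k) div k" using k n64 by (intro zdiv_mono1) auto
      also have "\<dots> = int (312 * L)" using k n64 by simp
      finally show ?thesis .
    qed
    then have ak: "(int (3 * n + 2 * n * L) + int n) div ((int n - 1) div 2 div 13) \<le> int (312 * (c * l))"
      by (simp only: R_def k_def L_def)
    have "measure_pmf.prob (random_patterns A n \<alpha>) (aperiodic_event A n :: ('a, 'd) config set set)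
      \<le> real (L * B * ((2 * (R + 2 * n) + 1) ^ (2 * ?d)) ^ (J * J + J * (4 ^ ?d * l))) * \<theta> ^ n"
      unfolding B_def R_def J_def
      by (rule prob_aperiodic_le[OF A \<alpha>(1,2) _ nl(1) \<delta> _ ak \<theta>(3)]) (use n64 BL \<theta>(2) in \<open>auto simp: B_def\<close>)
    also have "\<dots> \<le> real (2 ^ (C * l ^ (2 * ?d + 2))) * \<theta> ^ n"
      using count(2) \<theta>(1) by (intro mult_right_mono) (auto simp only: of_nat_le_iff zero_le_power less_imp_le)
    also have "\<dots> = (2 ^ (C * l ^ (2 * ?d + 2)) * \<beta> ^ n) * \<beta> ^ n"
      using \<beta>(3) by (simp add: power_mult_distrib[symmetric])
    also have "\<dots> \<le> 1 * \<beta> ^ n"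
      using l0[OF l(2) nl(2)] \<beta>(1) by (intro mult_right_mono) auto
    finally show "measure_pmf.prob (random_patterns A n \<alpha>) (aperiodic_event A n :: ('a, 'd) config set set) \<le> \<beta> ^ n"
      by simp
  qed (use \<beta> in auto)
qed

section \<open>Periodic sequences and the supercritical case\<close>

definition periodic_seqs :: "'a set \<Rightarrow> nat \<Rightarrow> (int \<Rightarrow> 'a) set" where
  "periodic_seqs A k = {y. range y \<subseteq> A \<and> (\<forall>j. y (j + int k) = y j)}"

text \<open>For \<open>0 < k\<close> these are the sequences of least period \<open>k\<close>, the
  two-sided repetitions of primitive words; their orbits correspond to aperiodic necklaces.\<close>

definition primitive_seqs :: "'a set \<Rightarrow> nat \<Rightarrow> (int \<Rightarrow> 'a) set" where
  "primitive_seqs A k = {y \<in> periodic_seqs A k. \<forall>j. 0 < j \<longrightarrow> j < k \<longrightarrow> y \<notin> periodic_seqs A j}"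

definition seq_orbit :: "(int \<Rightarrow> 'a) \<Rightarrow> (int \<Rightarrow> 'a) set" where
  "seq_orbit y = range (\<lambda>p j. y (j + p))"

lemma periodic_seqs_add_mult:
  assumes "y \<in> periodic_seqs A k" shows "y (j + int k * m) = y j"
proof -
  have per: "y (j + int k) = y j" for j using assms by (simp add: periodic_seqs_def)
  have nat_case: "y (j + int k * int a) = y j" for j a
  proof (induction a)
    case (Suc a)
    have "j + int k * int (Suc a) = (j + int k * int a) + int k" by (simp add: algebra_simps)
    have "y ((j + int k * int a) + int k) = y j" using Suc per by (simp only:)
    then show ?case by (simp only: \<open>j + int k * int (Suc a) = (j + int k * int a) + int k\<close>)
  qed simp
  show ?thesis
  proof (cases "0 \<le> m")
    case True
    then show ?thesis using nat_case[of j "nat m"] by simp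
  next
    case False
    then have "(j + int k * m) + int k * int (nat (- m)) = j" by (simp add: algebra_simps)
    then show ?thesis using nat_case[of "j + int k * m" "nat (- m)"] by (simp only:)
  qed
qed

lemma periodic_seqs_mod:
  assumes "y \<in> periodic_seqs A k" shows "y (j mod int k) = y j"
proof -
  have "j mod int k + int k * (j div int k) = j" by simp
  then show ?thesis using periodic_seqs_add_mult[OF assms, of "j mod int k" "j div int k"] by simp
qed

lemma periodic_seqs_bij:
  assumes "0 < k"
  shows "bij_betw (\<lambda>y. restrict y {0..<int k}) (periodic_seqs A k) ({0..<int k} \<rightarrow>\<^sub>E A)"
proof (rule bij_betwI[where g = "\<lambda>w j. w (j mod int k)"])
  show "(\<lambda>y. restrict y {0..<int k}) \<in> periodic_seqs A k \<rightarrow> {0..<int k} \<rightarrow>\<^sub>E A"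
    by (auto simp: periodic_seqs_def)
  show "(\<lambda>w j. w (j mod int k)) \<in> ({0..<int k} \<rightarrow>\<^sub>E A) \<rightarrow> periodic_seqs A k"
    using assms by (auto simp: periodic_seqs_def PiE_def Pi_def)
  show "(\<lambda>j. restrict y {0..<int k} (j mod int k)) = y" if "y \<in> periodic_seqs A k" for y
    using assms periodic_seqs_mod[OF that] by (auto simp: fun_eq_iff)
  show "restrict (\<lambda>j. w (j mod int k)) {0..<int k} = w" if "w \<in> {0..<int k} \<rightarrow>\<^sub>E A" for w
    using that by (auto simp: fun_eq_iff PiE_def extensional_def)
qed

lemma card_periodic_seqs:
  assumes "0 < k" "finite A"
  shows "finite (periodic_seqs A k)" "card (periodic_seqs A k) = card A ^ k"
proof -
  have "finite ({0..<int k} \<rightarrow>\<^sub>E A)" by (intro finite_PiE) (use assms in auto)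
  then show "finite (periodic_seqs A k)" using bij_betw_finite[OF periodic_seqs_bij[OF assms(1)]] by blast
  show "card (periodic_seqs A k) = card A ^ k"
    using bij_betw_same_card[OF periodic_seqs_bij[OF assms(1), of A]] by (simp add: card_PiE)
qed

text \<open>The least period \<open>j\<close> divides \<open>k\<close>, as \<open>k mod j\<close> is
  again a period; being a proper divisor it is at most \<open>k div 2\<close>.\<close>

lemma not_primitive_period:
  assumes "0 < k" "y \<in> periodic_seqs A k" "y \<notin> primitive_seqs A k"
  shows "\<exists>j\<in>{1..k div 2}. y \<in> periodic_seqs A j"
proof -
  define j where "j = (LEAST j. 0 < j \<and> y \<in> periodic_seqs A j)"
  have j: "0 < j \<and> y \<in> periodic_seqs A j" unfolding j_def by (rule LeastI[of _ k]) (use assms in simp)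
  have min: "\<not> (0 < i \<and> y \<in> periodic_seqs A i)" if "i < j" for i
    using that not_less_Least unfolding j_def by blast
  obtain i where i: "0 < i" "i < k" "y \<in> periodic_seqs A i" using assms by (auto simp: primitive_seqs_def)
  then have jk: "j < k" using min[of i] by linarith
  have "y \<in> periodic_seqs A (k mod j)"
  proof -
    have "y (p + int (k mod j)) = y p" for p
    proof -
      have "p + int (k mod j) + int j * int (k div j) = p + int k"
        by (simp add: zmod_int zdiv_int)
      then have "y (p + int (k mod j)) = y (p + int k)"
        using periodic_seqs_add_mult[of y A j "p + int (k mod j)" "int (k div j)"] j by (simp only:)
      then show ?thesis using assms(2) by (simp add: periodic_seqs_def)
    qed
    then show ?thesis using j by (simp add: periodic_seqs_def)
  qed
  then have "k mod j = 0" using min[of "k mod j"] j by simp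
  then obtain m where m: "k = j * m" by (auto simp: mod_eq_0_iff_dvd)
  with jk have "2 \<le> m" using assms(1) by (cases m; cases "m - 1") auto
  then have "j * 2 \<le> k" unfolding m by (rule mult_left_mono) simp
  then have "j \<le> k div 2" by linarith
  then show ?thesis using j by (intro bexI[of _ j]) auto
qed

text \<open>The non-primitive sequences number at most a geometric sum up to \<open>k div 2\<close>,
  hence at most \<open>2 * card A ^ (k div 2)\<close>. This is at most half of
  \<open>card A ^ k\<close>, since \<open>k div 2 + 2 \<le> k\<close> for
  \<open>3 \<le> k\<close>.\<close>

lemma card_primitive_seqs:
  assumes A: "finite A" "2 \<le> card A" and k: "3 \<le> k"
  shows "card A ^ k \<le> 2 * card (primitive_seqs A k)"
proof -
  let ?q = "card A"
  define m where "m = k div 2"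
  have fin: "finite (primitive_seqs A k)"
    by (rule finite_subset[OF _ card_periodic_seqs(1)[of k A]]) (use A k in \<open>auto simp: primitive_seqs_def\<close>)
  have S: "(\<Sum>j=1..m. ?q ^ j) \<le> 2 * ?q ^ m" for m
  proof (induction m)
    case (Suc m)
    have "2 * ?q ^ m \<le> ?q * ?q ^ m" using A by (intro mult_right_mono) auto
    moreover have "(\<Sum>j=1..Suc m. ?q ^ j) = (\<Sum>j=1..m. ?q ^ j) + ?q ^ Suc m" by simp
    ultimately show ?case using Suc by (simp only: power_Suc)
  qed simp
  have "periodic_seqs A k \<subseteq> primitive_seqs A k \<union> (\<Union>j\<in>{1..m}. periodic_seqs A j)"
    using not_primitive_period[of k _ A] k unfolding m_def by auto
  then have "card (periodic_seqs A k) \<le> card (primitive_seqs A k \<union> (\<Union>j\<in>{1..m}. periodic_seqs A j))"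
    by (intro card_mono finite_UnI fin finite_UN_I card_periodic_seqs(1) A) auto
  also have "\<dots> \<le> card (primitive_seqs A k) + card (\<Union>j\<in>{1..m}. periodic_seqs A j)" by (rule card_Un_le)
  also have "card (\<Union>j\<in>{1..m}. periodic_seqs A j) \<le> (\<Sum>j\<in>{1..m}. card (periodic_seqs A j))"
    by (rule card_UN_le) simp
  also have "\<dots> = (\<Sum>j=1..m. ?q ^ j)" using A by (intro sum.cong refl card_periodic_seqs) auto
  finally have 1: "?q ^ k \<le> card (primitive_seqs A k) + 2 * ?q ^ m"
    using S[of m] card_periodic_seqs(2)[of k A] A k by simp
  have "4 * ?q ^ m \<le> ?q ^ (m + 2)"
  proof -
    have "2 * 2 \<le> ?q * ?q" using A by (intro mult_mono) auto
    then have "4 * ?q ^ m \<le> (?q * ?q) * ?q ^ m" by (intro mult_right_mono) auto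
    then show ?thesis by (simp add: mult.assoc)
  qed
  also have "\<dots> \<le> ?q ^ k" using A k by (intro power_increasing) (auto simp: m_def)
  finally show ?thesis using 1 by linarith
qed

lemma seq_orbit_self: "y \<in> seq_orbit y"
  unfolding seq_orbit_def by (rule range_eqI[of _ _ 0]) simp

lemma seq_orbit_eq:
  assumes "z \<in> seq_orbit y" shows "seq_orbit z = seq_orbit y"
proof -
  obtain p where z: "z = (\<lambda>j. y (j + p))" using assms by (auto simp: seq_orbit_def)
  have "seq_orbit z = (\<lambda>s j. y (j + s)) ` range (\<lambda>r. r + p)"
    unfolding seq_orbit_def z image_image by (simp add: add.assoc)
  also have "range (\<lambda>r. r + p) = UNIV" by (rule surjI[where f = "\<lambda>r. r - p"]) simp
  finally show ?thesis by (simp add: seq_orbit_def)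
qed

lemma shift_periodic_seqs:
  assumes "z \<in> seq_orbit y" "y \<in> periodic_seqs A k" shows "z \<in> periodic_seqs A k"
proof -
  obtain p where z: "z = (\<lambda>j. y (j + p))" using assms(1) by (auto simp: seq_orbit_def)
  have "y (j + int k + p) = y (j + p)" for j
  proof -
    have "j + int k + p = j + p + int k" by simp
    then show ?thesis using assms(2) by (simp only: periodic_seqs_def mem_Collect_eq)
  qed
  then show ?thesis using assms(2) by (auto simp: periodic_seqs_def z)
qed

text \<open>A shift can be undone, so a shorter period of \<open>z\<close> would also be one of
  \<open>y\<close>.\<close>

lemma seq_orbit_subset_primitive:
  assumes "y \<in> primitive_seqs A k" shows "seq_orbit y \<subseteq> primitive_seqs A k"
proof
  fix z assume z: "z \<in> seq_orbit y"
  have "y \<in> seq_orbit z" using seq_orbit_eq[OF z] seq_orbit_self by metis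
  then have "y \<in> periodic_seqs A j" if "z \<in> periodic_seqs A j" for j using shift_periodic_seqs that by metis
  then show "z \<in> primitive_seqs A k"
    using assms shift_periodic_seqs[OF z, of A k] unfolding primitive_seqs_def by blast
qed

lemma card_seq_orbit:
  assumes "y \<in> periodic_seqs A k" "0 < k"
  shows "finite (seq_orbit y)" "card (seq_orbit y) \<le> k"
proof -
  have sub: "seq_orbit y \<subseteq> (\<lambda>p j. y (j + p)) ` {0..<int k}"
    unfolding seq_orbit_def
  proof clarify
    fix p
    have "y (j + p) = y (j + p mod int k)" for j
      using periodic_seqs_mod[OF assms(1), of "j + p"] periodic_seqs_mod[OF assms(1), of "j + p mod int k"]
      by (simp add: mod_simps)
    then have "(\<lambda>j. y (j + p)) = (\<lambda>j. y (j + p mod int k))" by blast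
    moreover have "p mod int k \<in> {0..<int k}" using assms(2) by simp
    ultimately show "(\<lambda>j. y (j + p)) \<in> (\<lambda>p j. y (j + p)) ` {0..<int k}" by blast
  qed
  show "finite (seq_orbit y)" by (rule finite_subset[OF sub]) simp
  have "card (seq_orbit y) \<le> card ((\<lambda>p j. y (j + p)) ` {0..<int k})" by (rule card_mono[OF _ sub]) simp
  also have "\<dots> \<le> card {0..<int k}" by (rule card_image_le) simp
  finally show "card (seq_orbit y) \<le> k" by simp
qed

text \<open>A weak form of the Fine--Wilf theorem; the sharp length of the window is \<open>k + k' - gcd k k'\<close>.\<close>

lemma periodic_seqs_eqI:
  assumes y: "y \<in> periodic_seqs A k" "0 < k" and z: "z \<in> periodic_seqs A k'" "0 < k'"
    and eq: "\<And>j. 1 \<le> j \<Longrightarrow> j \<le> int (k + k') \<Longrightarrow> y j = z j"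
  shows "y = z"
proof -
  have yp: "y (j + int k) = y j" and zp: "z (j + int k') = z j" for j
    using y z by (simp_all add: periodic_seqs_def)
  have red: "\<exists>i. 1 \<le> i \<and> i \<le> int m \<and> (\<exists>a. j = i + int m * a)" if "0 < m" for j :: int and m
  proof (intro exI conjI)
    show "1 \<le> (j - 1) mod int m + 1" "(j - 1) mod int m + 1 \<le> int m" 
      using that pos_mod_sign[of "int m" "j - 1"] pos_mod_bound[of "int m" "j - 1"] by linarith+
    have "(j - 1) mod int m + int m * ((j - 1) div int m) = j - 1" by simp
    then show "j = (j - 1) mod int m + 1 + int m * ((j - 1) div int m)" by linarith
  qed
  \<comment> \<open>Multiples of \<open>k\<close> move the position into \<open>1..k\<close>; then
    it and its translate by \<open>k'\<close> both lie in the window, where \<open>y\<close> equals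
    \<open>z\<close> and \<open>z\<close> has period \<open>k'\<close>.\<close>
  have yk': "y (j + int k') = y j" for j
  proof -
    obtain i a where i: "1 \<le> i" "i \<le> int k" "j = i + int k * a" using red[OF y(2), of j] by blast
    have "y (i + int k') = z (i + int k')" using i y(2) by (intro eq) auto
    also have "\<dots> = z i" by (rule zp)
    also have "\<dots> = y i" using i by (intro eq[symmetric]) auto
    finally have "y (i + int k') = y i" .
    moreover have "y (i + int k' + int k * a) = y (i + int k')" "y (i + int k * a) = y i"
      by (rule periodic_seqs_add_mult[OF y(1)])+
    moreover have "j + int k' = i + int k' + int k * a" using i(3) by simp
    ultimately show ?thesis using i(3) by (simp only:)
  qed
  have y': "y \<in> periodic_seqs A k'" using y(1) yk' by (simp add: periodic_seqs_def)
  show ?thesis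
  proof
    fix j
    obtain i a where i: "1 \<le> i" "i \<le> int k'" "j = i + int k' * a" using red[OF z(2), of j] by blast
    then show "y j = z j"
      using eq[of i] periodic_seqs_add_mult[OF y', of i a] periodic_seqs_add_mult[OF z(1), of i a] by simp
  qed
qed

section \<open>Configurations that depend on one coordinate\<close>

definition line :: "'d::finite \<Rightarrow> (int \<Rightarrow> 'a) \<Rightarrow> ('a, 'd) config" where
  "line i y = (\<lambda>p. y (p $ i))"

text \<open>Every pattern of \<open>line i y\<close> is thus read at the origin from an element of
  the orbit of \<open>y\<close>, so there are at most as many patterns as orbit elements.\<close>

lemma pat_line: "pat n (line i y) p = pat n (line i (\<lambda>j. y (j + p $ i))) 0"
  unfolding pat_eq_iff line_def by (simp add: add.commute)

lemma line_finite_orbit: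
  assumes y: "y \<in> periodic_seqs A k" "0 < k"
    and sub: "(\<lambda>z. pat n (line i z) 0) ` seq_orbit y \<subseteq> \<omega>"
  shows "\<exists>\<gamma>. finite_orbit (SFT A n \<omega>) \<gamma>"
proof (rule periodic_imp_finite_orbit[where y = "line i y" and \<pi> = "\<lambda>_. int k"])
  show "line i y c = line i y c'" if "\<And>j. c $ j mod int k = c' $ j mod int k" for c c'
    using that[of i] periodic_seqs_mod[OF y(1), of "c $ i"] periodic_seqs_mod[OF y(1), of "c' $ i"]
    by (simp add: line_def)
  have "pat n (line i y) p \<in> \<omega>" for p
    using sub unfolding pat_line[of n i y p] seq_orbit_def by blast
  moreover have "range (line i y) \<subseteq> A" using y(1) by (auto simp: line_def periodic_seqs_def)
  ultimately show "line i y \<in> SFT A n \<omega>" unfolding SFT_iff by blast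
qed (use y in simp)

text \<open>On the event, no primitive orbit has all its patterns allowed. Distinct orbits use
  disjoint sets of patterns, so these conditions are independent, and
  \<open>1 - t \<le> exp (- t)\<close> turns the product into the exponential of a sum.\<close>

lemma prob_aperiodic_le_exp:
  fixes A :: "'a set" and \<alpha> :: real
  assumes A: "finite A" "2 \<le> card A" and \<alpha>: "0 \<le> \<alpha>" "\<alpha> \<le> 1"
  shows "measure_pmf.prob (random_patterns A n \<alpha>) (aperiodic_event A n :: ('a, 'd::finite) config set set)
    \<le> exp (- (\<Sum>k=3..n div 2. (\<alpha> * real (card A)) ^ k / (2 * real k)))"
proof -
  let ?K = "{3..n div 2}"
  \<comment> \<open>Any coordinate serves; \<open>undefined\<close> merely picks one.\<close>
  define i :: 'd where "i = undefined"
  define S where "S Q = (\<lambda>z. pat n (line i z) 0) ` Q" for Q :: "(int \<Rightarrow> 'a) set"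
  define F where "F k = seq_orbit ` primitive_seqs A k" for k
  have finprim: "finite (primitive_seqs A k)" if "k \<in> ?K" for k
    by (rule finite_subset[OF _ card_periodic_seqs(1)[of k A]]) (use A that in \<open>auto simp: primitive_seqs_def\<close>)
  then have finF: "finite (F k)" if "k \<in> ?K" for k using that by (simp add: F_def)
  have per: "y \<in> periodic_seqs A k" if "y \<in> primitive_seqs A k" for y k using that by (simp add: primitive_seqs_def)
  \<comment> \<open>A common \<open>n\<close>-pattern makes two sequences agree on
    \<open>1..n\<close>, and \<open>k + k' \<le> n\<close> as both periods are at most
    \<open>n div 2\<close>; so the sequences coincide, and with them their orbits.\<close>
  have inj: "Q = Q'"
    if Q: "Q \<in> (\<Union>k\<in>?K. F k)" and Q': "Q' \<in> (\<Union>k\<in>?K. F k)" and meet: "S Q \<inter> S Q' \<noteq> {}" for Q Q'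
  proof -
    obtain k y where k: "k \<in> ?K" "y \<in> primitive_seqs A k" "Q = seq_orbit y" using Q by (auto simp: F_def)
    obtain k' y' where k': "k' \<in> ?K" "y' \<in> primitive_seqs A k'" "Q' = seq_orbit y'" using Q' by (auto simp: F_def)
    obtain z z' where z: "z \<in> Q" "z' \<in> Q'" "pat n (line i z) 0 = pat n (line i z') 0"
      using meet by (auto simp: S_def)
    have "z = z'"
    proof (rule periodic_seqs_eqI[of z A k z' k'])
      show "z \<in> periodic_seqs A k" using shift_periodic_seqs z(1) k per by blast
      show "z' \<in> periodic_seqs A k'" using shift_periodic_seqs z(2) k' per by blast
      fix j assume j: "1 \<le> j" "j \<le> int (k + k')"
      have "j \<le> int n" using j(2) k(1) k'(1) by auto
      then have "(\<chi> _. j) \<in> (cube n :: (int ^ 'd) set)" using j by (simp add: cube_def)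
      then have "line i z (0 + (\<chi> _. j)) = line i z' (0 + (\<chi> _. j))" using z(3) unfolding pat_eq_iff by blast
      then show "z j = z' j" by (simp add: line_def)
    qed (use k k' in auto)
    then show ?thesis using z k(3) k'(3) seq_orbit_eq by metis
  qed
  have disj: "disjoint_family_on S (\<Union>k\<in>?K. F k)"
    using inj unfolding disjoint_family_on_def by blast
  have Fdisj: "F k \<inter> F k' = {}" if "k \<in> ?K" "k' \<in> ?K" "k \<noteq> k'" for k k'
  proof (rule ccontr)
    assume "F k \<inter> F k' \<noteq> {}"
    then obtain y y' where "y \<in> primitive_seqs A k" "y' \<in> primitive_seqs A k'" "seq_orbit y = seq_orbit y'"
      by (auto simp: F_def)
    then have y: "y \<in> primitive_seqs A k" "y \<in> primitive_seqs A k'"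
      using seq_orbit_self[of y] seq_orbit_subset_primitive by blast+
    then have "\<not> k < k'" "\<not> k' < k" using that by (auto simp: primitive_seqs_def)
    then show False using that(3) by linarith
  qed
  have Spat: "S Q \<subseteq> patterns A n" if Q: "Q \<in> (\<Union>k\<in>?K. F k)" for Q
  proof
    fix w assume "w \<in> S Q"
    then obtain z where z: "z \<in> Q" "w = pat n (line i z) 0" by (auto simp: S_def)
    obtain k y where "y \<in> primitive_seqs A k" "Q = seq_orbit y" using Q by (auto simp: F_def)
    then have "z \<in> periodic_seqs A k" using z(1) shift_periodic_seqs per by blast
    then have "range (line i z) \<subseteq> A" by (auto simp: line_def periodic_seqs_def)
    then show "w \<in> patterns A n" unfolding z(2) by (rule pat_in_patterns)
  qed
  have "aperiodic_event A n \<subseteq> {\<omega>. \<forall>Q\<in>(\<Union>k\<in>?K. F k). \<not> S Q \<subseteq> \<omega>}"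
  proof clarify
    fix \<omega> k Q assume *: "\<omega> \<in> aperiodic_event A n" "k \<in> ?K" "Q \<in> F k" "S Q \<subseteq> \<omega>"
    obtain y where y: "y \<in> primitive_seqs A k" "Q = seq_orbit y" using *(3) by (auto simp: F_def)
    have "\<exists>\<gamma>. finite_orbit (SFT A n \<omega>) \<gamma>"
      by (rule line_finite_orbit[OF per[OF y(1)], where i = i]) (use * y in \<open>auto simp: S_def\<close>)
    then show False using *(1) by (auto simp: aperiodic_event_def)
  qed
  then have "measure_pmf.prob (random_patterns A n \<alpha>) (aperiodic_event A n :: ('a, 'd) config set set)
      \<le> measure_pmf.prob (random_patterns A n \<alpha>) {\<omega>. \<forall>Q\<in>(\<Union>k\<in>?K. F k). \<not> S Q \<subseteq> \<omega>}"
    by (intro measure_pmf.finite_measure_mono) auto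
  also have "\<dots> = (\<Prod>Q\<in>(\<Union>k\<in>?K. F k). 1 - \<alpha> ^ card (S Q))"
    by (rule prob_random_patterns_no_block[OF A(1) \<alpha> _ Spat disj]) (use finF in auto)
  also have "\<dots> \<le> (\<Prod>Q\<in>(\<Union>k\<in>?K. F k). exp (- (\<alpha> ^ card (S Q))))"
  proof (rule prod_mono)
    fix Q
    have "\<alpha> ^ card (S Q) \<le> 1" using \<alpha> by (simp add: power_le_one)
    then show "0 \<le> 1 - \<alpha> ^ card (S Q) \<and> 1 - \<alpha> ^ card (S Q) \<le> exp (- (\<alpha> ^ card (S Q)))"
      using exp_ge_add_one_self[of "- (\<alpha> ^ card (S Q))"] by simp
  qed
  also have "\<dots> = exp (\<Sum>Q\<in>(\<Union>k\<in>?K. F k). - (\<alpha> ^ card (S Q)))"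
    by (subst exp_sum) (use finF in auto)
  also have "\<dots> = exp (- (\<Sum>Q\<in>(\<Union>k\<in>?K. F k). \<alpha> ^ card (S Q)))" by (simp add: sum_negf)
  also have "\<dots> \<le> exp (- (\<Sum>k\<in>?K. (\<alpha> * real (card A)) ^ k / (2 * real k)))"
  proof -
    have "(\<Sum>k\<in>?K. (\<alpha> * real (card A)) ^ k / (2 * real k)) \<le> (\<Sum>k\<in>?K. \<Sum>Q\<in>F k. \<alpha> ^ card (S Q))"
    proof (rule sum_mono)
      fix k assume k: "k \<in> ?K"
      have orb: "finite Q \<and> card Q \<le> k" if "Q \<in> F k" for Q
        using that card_seq_orbit[OF per, of _ k] k unfolding F_def by auto
      \<comment> \<open>Orbits of size at most \<open>k\<close> cover all primitive sequences, so
        there are at least \<open>card A ^ k / (2 * k)\<close> orbits.\<close>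
      have "primitive_seqs A k \<subseteq> \<Union> (F k)" using seq_orbit_self by (auto simp: F_def)
      then have "card (primitive_seqs A k) \<le> card (\<Union> (F k))" by (intro card_mono) (use finF[OF k] orb in auto)
      also have "\<dots> \<le> (\<Sum>Q\<in>F k. card Q)" by (rule card_Union_le_sum_card) 
      also have "\<dots> \<le> (\<Sum>Q\<in>F k. k)" by (rule sum_mono) (use orb in auto)
      finally have "card A ^ k \<le> 2 * (card (F k) * k)" using card_primitive_seqs[OF A, of k] k by simp
      then have "real (card A ^ k) \<le> real (2 * (card (F k) * k))" by (simp only: of_nat_le_iff)
      then have cF: "real (card A) ^ k / (2 * real k) \<le> real (card (F k))" using k by (simp add: field_simps)
      have "(\<alpha> * real (card A)) ^ k / (2 * real k) = real (card A) ^ k / (2 * real k) * \<alpha> ^ k"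
        by (simp add: power_mult_distrib)
      also have "\<dots> \<le> real (card (F k)) * \<alpha> ^ k" using cF \<alpha>(1) by (intro mult_right_mono) auto
      also have "\<dots> = (\<Sum>Q\<in>F k. \<alpha> ^ k)" by simp
      also have "\<dots> \<le> (\<Sum>Q\<in>F k. \<alpha> ^ card (S Q))"
      proof (rule sum_mono)
        fix Q assume "Q \<in> F k"
        then have "card (S Q) \<le> k" using orb card_image_le[of Q "\<lambda>z. pat n (line i z) 0"] unfolding S_def by fastforce
        then show "\<alpha> ^ k \<le> \<alpha> ^ card (S Q)" using \<alpha> by (intro power_decreasing) auto
      qed
      finally show "(\<alpha> * real (card A)) ^ k / (2 * real k) \<le> (\<Sum>Q\<in>F k. \<alpha> ^ card (S Q))" .
    qed
    also have "\<dots> = (\<Sum>Q\<in>(\<Union>k\<in>?K. F k). \<alpha> ^ card (S Q))"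
      by (rule sum.UNION_disjoint[symmetric]) (use finF Fdisj in auto)
    finally show ?thesis by simp
  qed
  finally show ?thesis .
qed

text \<open>Over one letter the only configuration is constant, and its orbit is finite.\<close>

lemma aperiodic_event_singleton:
  assumes "card A = 1" shows "(aperiodic_event A n :: ('a, 'd::finite) config set set) = {}"
proof -
  obtain a where A: "A = {a}" using assms by (auto simp: card_1_singleton_iff)
  have "\<exists>\<gamma>. finite_orbit (SFT A n \<omega>) \<gamma>" if "x \<in> SFT A n \<omega>" for x :: "('a, 'd) config" and \<omega>
  proof (rule periodic_imp_finite_orbit[OF _ _ that])
    have "x c = a" for c using that by (auto simp: SFT_iff A)
    then show "x c = x c'" for c c' by simp
  qed (rule zero_less_one)
  then show ?thesis by (auto simp: aperiodic_event_def)
qed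

lemma filterlim_div_2: "filterlim (\<lambda>n::nat. n div 2) at_top sequentially"
  unfolding filterlim_at_top
proof
  fix Z :: nat
  have "Z \<le> n div 2" if "2 * Z \<le> n" for n using that by linarith
  then show "\<forall>\<^sub>F n in sequentially. Z \<le> n div 2" using eventually_sequentially by blast
qed

text \<open>Each term of the exponent is at least \<open>1 / (2 * k)\<close>, so the divergence of
  the harmonic series suffices.\<close>

lemma prob_aperiodic_tendsto_0:
  fixes A :: "'a set"
  assumes A: "finite A" "2 \<le> card A" and \<alpha>: "0 \<le> \<alpha>" "\<alpha> \<le> 1" "1 \<le> \<alpha> * real (card A)"
  shows "(\<lambda>n. measure_pmf.prob (random_patterns A n \<alpha>) (aperiodic_event A n :: ('a, 'd::finite) config set set)) \<longlonglongrightarrow> 0"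
proof -
  define H where "H m = (\<Sum>k=3..m. (\<alpha> * real (card A)) ^ k / (2 * real k))" for m
  have "filterlim H at_top sequentially"
  proof (rule filterlim_at_top_mono)
    have "filterlim (\<lambda>m. harm m :: real) at_top sequentially" by (rule harm_at_top)
    then have "filterlim (\<lambda>m. - 3 / 4 + 1 / 2 * (harm m :: real)) at_top sequentially"
      by (intro filterlim_tendsto_add_at_top[OF tendsto_const] filterlim_tendsto_pos_mult_at_top[OF tendsto_const]) auto
    then show "filterlim (\<lambda>m. - 3 / 4 + 1 / 2 * (harm m :: real)) at_top sequentially" .
    \<comment> \<open>The sum starts at 3; \<open>3 / 4\<close> is half of the omitted harmonic
      terms \<open>1 + 1 / 2\<close>.\<close>
    show "\<forall>\<^sub>F m in sequentially. - 3 / 4 + 1 / 2 * (harm m :: real) \<le> H m"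
    proof (rule eventually_sequentiallyI[of 3])
      fix m :: nat assume m: "3 \<le> m"
      have "{1..m} = {1, 2} \<union> {3..m}" using m by auto
      then have "harm m = (\<Sum>k\<in>{1, 2::nat}. inverse (real k)) + (\<Sum>k=3..m. inverse (real k))"
        unfolding harm_def by (simp only:) (subst sum.union_disjoint, auto)
      then have "- 3 / 4 + 1 / 2 * harm m = (\<Sum>k=3..m. 1 / (2 * real k))"
        by (simp add: sum_distrib_left field_simps)
      also have "\<dots> \<le> H m"
        unfolding H_def using \<alpha>(3) by (intro sum_mono divide_right_mono) (auto intro: one_le_power)
      finally show "- 3 / 4 + 1 / 2 * harm m \<le> H m" .
    qed
  qed
  then have "filterlim (\<lambda>n. H (n div 2)) at_top sequentially" by (rule filterlim_compose[OF _ filterlim_div_2])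
  then have "filterlim (\<lambda>n. - H (n div 2)) at_bot sequentially" by (simp add: filterlim_uminus_at_bot)
  then have lim: "(\<lambda>n. exp (- H (n div 2))) \<longlonglongrightarrow> 0" by (rule filterlim_compose[OF exp_at_bot])
  show ?thesis
  proof (rule tendsto_sandwich[OF _ _ tendsto_const lim])
    show "\<forall>\<^sub>F n in sequentially. measure_pmf.prob (random_patterns A n \<alpha>)
        (aperiodic_event A n :: ('a, 'd) config set set) \<le> exp (- H (n div 2))"
      unfolding H_def by (intro always_eventually allI prob_aperiodic_le_exp A \<alpha>)
  qed (simp add: measure_nonneg)
qed

text \<open>The last term of the sum, at \<open>k = n div 2\<close>, is alone at least
  \<open>n\<close> for large \<open>n\<close>.\<close>

lemma prob_aperiodic_supercritical:
  fixes A :: "'a set"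
  assumes A: "finite A" "2 \<le> card A" and \<alpha>: "0 \<le> \<alpha>" "\<alpha> \<le> 1" "1 < \<alpha> * real (card A)"
  shows "\<exists>n0. \<forall>n\<ge>n0. measure_pmf.prob (random_patterns A n \<alpha>) (aperiodic_event A n :: ('a, 'd::finite) config set set)
    \<le> exp (- 1) ^ n"
proof -
  define s where "s = \<alpha> * real (card A)"
  \<comment> \<open>From \<open>3 * m \<le> t ^ m\<close> follows
    \<open>9 * m ^ 2 \<le> s ^ m\<close>, which is at least \<open>2 * m * n\<close> because
    \<open>n \<le> 3 * m\<close>.\<close>
  define t where "t = sqrt s"
  have t: "1 < t" "t * t = s" using \<alpha>(3) by (auto simp: t_def s_def)
  have "(\<lambda>m. real m * (1 / t) ^ m) \<longlonglongrightarrow> 0" by (rule powser_times_n_limit_0) (use t in auto)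
  then have "\<forall>\<^sub>F m in sequentially. real m * (1 / t) ^ m < 1 / 3" by (rule order_tendstoD) simp
  then obtain m0 where m0: "\<And>m. m0 \<le> m \<Longrightarrow> real m * (1 / t) ^ m < 1 / 3"
    unfolding eventually_sequentially by blast
  show ?thesis
  proof (intro exI[of _ "2 * m0 + 6"] allI impI)
    fix n assume n: "2 * m0 + 6 \<le> n"
    define m where "m = n div 2"
    have m: "m0 \<le> m" "3 \<le> m" "n \<le> 3 * m" using n by (auto simp: m_def)
    have "real m * (1 / t) ^ m < 1 / 3" by (rule m0[OF m(1)])
    then have mt: "3 * real m \<le> t ^ m" using t(1) by (simp add: field_simps)
    have "real n * (2 * real m) \<le> (3 * real m) * (3 * real m)" using m by (intro mult_mono) auto
    also have "\<dots> \<le> t ^ m * t ^ m" by (intro mult_mono mt) (use t in auto)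
    also have "\<dots> = s ^ m" using t(2) by (simp flip: power_mult_distrib)
    finally have "real n \<le> s ^ m / (2 * real m)" using m(2) by (simp add: field_simps)
    also have "\<dots> \<le> (\<Sum>k=3..m. s ^ k / (2 * real k))"
      by (rule member_le_sum) (use m \<alpha>(3) in \<open>auto simp: s_def\<close>)
    finally have "exp (- (\<Sum>k=3..m. s ^ k / (2 * real k))) \<le> exp (- real n)" by simp
    also have "exp (- real n) = exp (- 1) ^ n" using exp_of_nat_mult[of n "- 1 :: real"] by simp
    finally show "measure_pmf.prob (random_patterns A n \<alpha>) (aperiodic_event A n :: ('a, 'd) config set set) \<le> exp (- 1) ^ n"
      using prob_aperiodic_le_exp[OF A \<alpha>(1,2), of n, where 'd = 'd] unfolding s_def m_def by linarith
  qed
qed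

theorem theorem1p3:
  fixes A :: "'a set" and \<alpha> :: real
  assumes "finite A" and "A \<noteq> {}" and "0 \<le> \<alpha>" and "\<alpha> \<le> 1"
  shows "((\<lambda>n. measure_pmf.prob (random_patterns A n \<alpha>)
              (aperiodic_event A n :: ('a, 'd::finite) config set set)) \<longlonglongrightarrow> 0) \<and>
         (\<alpha> \<noteq> 1 / real (card A) \<longrightarrow>
           (\<exists>C>0. \<exists>\<beta>. 0 < \<beta> \<and> \<beta> < 1 \<and> (\<exists>n0. \<forall>n\<ge>n0.
             measure_pmf.prob (random_patterns A n \<alpha>)
              (aperiodic_event A n :: ('a, 'd) config set set) \<le> C * \<beta> ^ n)))"
proof -
  let ?p = "\<lambda>n. measure_pmf.prob (random_patterns A n \<alpha>) (aperiodic_event A n :: ('a, 'd) config set set)"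
  let ?rate = "\<exists>C>0. \<exists>\<beta>. 0 < \<beta> \<and> \<beta> < 1 \<and> (\<exists>n0. \<forall>n\<ge>n0. ?p n \<le> C * \<beta> ^ n)"
  have q: "0 < card A" using assms by (simp add: card_gt_0_iff)
  \<comment> \<open>The limit follows from an exponential rate, so it needs a separate argument only
    where no rate is shown.\<close>
  have rate_lim: "?p \<longlonglongrightarrow> 0" if ?rate
  proof -
    obtain C \<beta> n0 where *: "0 < \<beta>" "\<beta> < 1" "\<And>n. n0 \<le> n \<Longrightarrow> ?p n \<le> C * \<beta> ^ n" using \<open>?rate\<close> by blast
    have "(\<lambda>n. C * \<beta> ^ n) \<longlonglongrightarrow> C * 0" using * by (intro tendsto_mult tendsto_const LIMSEQ_power_zero) auto
    then have lim: "(\<lambda>n. C * \<beta> ^ n) \<longlonglongrightarrow> 0" by simp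
    show ?thesis
    proof (rule tendsto_sandwich[OF _ _ tendsto_const lim])
      show "\<forall>\<^sub>F n in sequentially. ?p n \<le> C * \<beta> ^ n" using *(3) by (rule eventually_sequentiallyI)
    qed (simp add: measure_nonneg)
  qed
  \<comment> \<open>One letter is separated off because periodic sequences are scarce there; with at
    least two letters the critical value is the only case without a rate.\<close>
  consider "\<alpha> * real (card A) < 1" | "card A = 1" | "2 \<le> card A" "1 < \<alpha> * real (card A)"
    | "2 \<le> card A" "\<alpha> * real (card A) = 1"
    using q by linarith
  then show ?thesis
  proof cases
    case 1
    obtain \<beta> n0 where \<beta>: "0 < \<beta>" "\<beta> < 1" "\<And>n. n0 \<le> n \<Longrightarrow> ?p n \<le> \<beta> ^ n"
      using prob_aperiodic_subcritical[OF assms 1] by blast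
    then have ?rate by (intro exI[of _ 1] conjI exI[of _ \<beta>] exI[of _ n0]) auto
    then show ?thesis using rate_lim by blast
  next
    case 2
    have "?p n = 0" for n by (simp add: aperiodic_event_singleton[OF 2])
    then have ?rate by (intro exI[of _ 1] conjI exI[of _ "1 / 2"] exI[of _ 0]) auto
    then show ?thesis using rate_lim by blast
  next
    case 3
    obtain n0 where "\<And>n. n0 \<le> n \<Longrightarrow> ?p n \<le> exp (- 1) ^ n"
      using prob_aperiodic_supercritical[OF assms(1) 3(1) assms(3,4) 3(2)] by blast
    then have ?rate by (intro exI[of _ 1] conjI exI[of _ "exp (- 1)"] exI[of _ n0]) auto
    then show ?thesis using rate_lim by blast
  next
    case 4
    then have "\<alpha> = 1 / real (card A)" using q by (simp add: field_simps)
    then show ?thesis using prob_aperiodic_tendsto_0[OF assms(1) 4(1) assms(3,4)] 4(2) by simp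
  qed
qed

end
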